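(* Let $J_f(\phi;\theta)$ and $J_v(\theta;\phi)$ be the KL-regularized generator and verifier objectives described in the context, and let $(\phi_t,\theta_t)$ be the alternating GRPO iterates $$\phi_{t+1}=\phi_t+\eta_t\left(\nabla_\phi J_f(\phi_t;\theta_t)+M^f_{t+1}+b^f_t\right),$$ $$\theta_{t+1}=\theta_t+\eta_t\left(\nabla_\theta J_v(\theta_t;\phi_{t+1})+M^v_{t+1}+b^v_t\right),$$ where $M^f_{t+1},M^v_{t+1}$ are noise terms and $b^f_t,b^v_t$ are bias terms (due to replay, stale log-probabilities and finite group normalization). Assume: (i) (Smoothness and compactness) the parameter domains for $\phi$ and $\theta$ are compact, or the iterates are projected to a compact set; $J_f$ and $J_v$ are continuously differentiable with Lipschitz gradients on this set. (ii) (Bounded noise) rewards and GRPO advantages are uniformly bounded; the noise terms $M^f_{t+1},M^v_{t+1}$ have bounded second moments and form martingale-difference sequences with respect to the training filtration. (iii) (Step sizes) $\sum_{t=1}^\infty\eta_t=\infty$ and $\sum_{t=1}^\infty\eta_t^2<\infty$. (iv) (Controlled bias) $\sum_{t=1}^\infty\eta_t\left(\|b^f_t\|+\|b^v_t\|\right)<\infty$. (v) (Infinite visitation) each role is updated infinitely often, and each decision branch appearing in the objectives is visited infinitely often; in particular, the SAC branch has nonzero visitation frequency along the training trajectory. Then the interpolated iterates form an asymptotic pseudo-trajectory of the game ODE $$\dot\phi=\nabla_\phi J_f(\phi;\theta),\qquad \dot\theta=\nabla_\theta J_v(\theta;\phi).$$ Consequently, every isolated asymptotically stable limit point $(\phi,\theta)$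 satisfies $$\nabla_\phi J_f(\phi;\theta)=0,\qquad \nabla_\theta J_v(\theta;\phi)=0,$$ and is therefore stationary for the game vector field $F(\phi,\theta)=(\nabla_\phi J_f(\phi;\theta),\nabla_\theta J_v(\theta;\phi))$.
   Context: **Game.** A task $\tau_0\sim\mathcal D$ is completed over a finite horizon $t=1,\dots,T$ of decision units $u_t$ (this game time is distinct from the training iteration index $t$ in the claim). The state is $m_t=(\tau_0,u_t,o_{<t})$, where $o_{<t}$ is the partial output submitted so far. A generator with parameters $\phi$ proposes $x_t\sim\pi^x_{f,\phi}(\cdot\mid m_t)$. A verifier with parameters $\theta$ chooses $y_t\sim\pi_{v,\theta}(\cdot\mid m_t,x_t)$, $y_t\in\{\mathrm{SAC},\mathrm{NS}\}$ ("safety assurance case" or "no SAC"). If $y_t=\mathrm{NS}$, $o_t=x_t$ is submitted. If $y_t=\mathrm{SAC}$ (the "SAC branch"), the generator draws a candidate revision $z_t\sim\pi^z_{f,\phi}(\cdot\mid m_t,x_t,y_t)$ and an action $a_t\sim\pi^a_{f,\phi}(\cdot\mid m_t,x_t,y_t,z_t)$, $a_t\in\{\mathrm{KEEP},\mathrm{REVISE}\}$; then $o_t=x_t$ if $a_t=\mathrm{KEEP}$ and $o_t=z_t$ if $a_t=\mathrm{REVISE}$. The state then becomes $m_{t+1}=T(m_t,x_t,y_t,a_t,o_t)$, appending $o_t$ to the partial output. **Rewards.** $S_x=\mathbf 1\{x_t\text{ is strictly correct}\}$, $S_z=\mathbf 1\{z_t\text{ is strictly correct}\}$, $c_{\mathrm{sac}}=1-S_x$.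 Verifier: $R_v(\mathrm{SAC}\mid m_t,x_t)=c_{\mathrm{sac}}$, $R_v(\mathrm{NS}\mid m_t,x_t)=1-c_{\mathrm{sac}}$. Generator on the SAC branch: $R_f(\mathrm{KEEP}\mid m_t,x_t,\mathrm{SAC})=S_x$, $R_f(\mathrm{REVISE}\mid m_t,x_t,\mathrm{SAC})=S_z$. **Objectives.** $\widetilde J_f(\phi;\theta)=\mathbb E_{\tau\sim d^{\phi,\theta}}[R_f(\tau)]$ and $\widetilde J_v(\theta;\phi)=\mathbb E_{\tau\sim d^{\phi,\theta}}[R_v(\tau)]$, where $d^{\phi,\theta}$ is the trajectory distribution induced by the two policies and $R_f(\tau),R_v(\tau)$ are the role rewards along $\tau$, built from the per-decision rewards above. With fixed reference policies (subscript $\mathrm{ref}$) and coefficients $\beta_v,\beta_{fx},\beta_{fz},\beta_{fa}$, $$J_v(\theta;\phi)=\widetilde J_v(\theta;\phi)-\beta_v\,\mathbb E_{I_v}\left[\mathrm{KL}\left(\pi_{v,\theta}(\cdot\mid I_v)\,\|\,\pi_{v,\mathrm{ref}}(\cdot\mid I_v)\right)\right],$$ $$J_f(\phi;\theta)=\widetilde J_f(\phi;\theta)-\sum_{k\in\{x,z,a\}}\beta_{fk}\,\mathbb E_{I_f^k}\left[\mathrm{KL}\left(\pi^k_{f,\phi}(\cdot\mid I_f^k)\,\|\,\pi^k_{f,\mathrm{ref}}(\cdot\mid I_f^k)\right)\right],$$ where $I_v=(m_t,x_t)$, $I_f^x=m_t$, $I_f^z=(m_t,x_t,y_t)$, $I_f^a=(m_t,x_t,y_t,z_t)$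 are the conditioning contexts of the respective policies. **GRPO advantages.** For a binary action group $\{a_1,a_2\}$ with rewards $R(a_1),R(a_2)$ and mean $\bar R$, the advantage is $A(a_i)=(R(a_i)-\bar R)/\left(\sqrt{\tfrac12\sum_{j=1}^2(R(a_j)-\bar R)^2}+\epsilon_A\right)$. **Interpolation and asymptotic pseudo-trajectory.** These are used in the standard stochastic-approximation sense: the iterates $(\phi_t,\theta_t)$ are interpolated affinely in continuous time with $(\phi_t,\theta_t)$ placed at time $s_t=\sum_{i<t}\eta_i$; a continuous path $X$ is an asymptotic pseudo-trajectory of the flow $\Phi$ of an ODE if for every $H>0$, $\lim_{s\to\infty}\sup_{0\le h\le H}\|X(s+h)-\Phi_h(X(s))\|=0$ (for the random iterates, almost surely).
   Formalization: In (i), smoothness with Lipschitz gradients is assumed on an open neighbourhood of the compact set, and projected iterates are covered only if the displayed recursion holds with projection corrections counted in the bias of (iv); persistently active projection makes the claim false. *)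

theory Defs
  imports "HOL-Probability.Probability"
begin

datatype verdict = SAC | NS
datatype choice = KEEP | REVISE

type_synonym ('task, 'u, 'out) state = "'task \<times> 'u \<times> 'out list"

text \<open>One decision \<open>(m, x, y, r)\<close>: state, proposal, verdict and, on the SAC branch only,
  \<open>r = Some (z, a)\<close> with the candidate revision and the generator's choice.\<close>

type_synonym ('task, 'u, 'out) decision =
  "('task, 'u, 'out) state \<times> 'out \<times> verdict \<times> ('out \<times> choice) option"

type_synonym ('task, 'u, 'out) trajectory = "('task, 'u, 'out) decision list"

text \<open>Generator parameters have type \<open>'p\<close>, verifier parameters type \<open>'q\<close>.
  \<open>correct m x\<close> says that \<open>x\<close> is strictly correct in state \<open>m\<close>. \<open>next_unit\<close> may use everything
  that is known after a decision, including the submitted output (its last argument).\<close>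

record ('task, 'u, 'out, 'p, 'q) game =
  tasks :: "'task pmf"
  horizon :: nat
  first_unit :: "'task \<Rightarrow> 'u"
  next_unit :: "('task, 'u, 'out) decision \<Rightarrow> 'out \<Rightarrow> 'u"
  correct :: "('task, 'u, 'out) state \<Rightarrow> 'out \<Rightarrow> bool"
  pol_x :: "'p \<Rightarrow> ('task, 'u, 'out) state \<Rightarrow> 'out pmf"
  pol_z :: "'p \<Rightarrow> ('task, 'u, 'out) state \<times> 'out \<times> verdict \<Rightarrow> 'out pmf"
  pol_a :: "'p \<Rightarrow> ('task, 'u, 'out) state \<times> 'out \<times> verdict \<times> 'out \<Rightarrow> choice pmf"
  pol_v :: "'q \<Rightarrow> ('task, 'u, 'out) state \<times> 'out \<Rightarrow> verdict pmf"
  ref_x :: "('task, 'u, 'out) state \<Rightarrow> 'out pmf"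
  ref_z :: "('task, 'u, 'out) state \<times> 'out \<times> verdict \<Rightarrow> 'out pmf"
  ref_a :: "('task, 'u, 'out) state \<times> 'out \<times> verdict \<times> 'out \<Rightarrow> choice pmf"
  ref_v :: "('task, 'u, 'out) state \<times> 'out \<Rightarrow> verdict pmf"
  beta_v :: real
  beta_x :: real
  beta_z :: real
  beta_a :: real

definition decision_pmf ::
  "('task, 'u, 'out, 'p, 'q) game \<Rightarrow> 'p \<Rightarrow> 'q \<Rightarrow> ('task, 'u, 'out) state \<Rightarrow>
    ('task, 'u, 'out) decision pmf" where
  "decision_pmf G \<phi> \<theta> m = do {
     x \<leftarrow> pol_x G \<phi> m;
     y \<leftarrow> pol_v G \<theta> (m, x);
     (case y of
        NS \<Rightarrow> return_pmf (m, x, NS, None)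
      | SAC \<Rightarrow> do {
          z \<leftarrow> pol_z G \<phi> (m, x, SAC);
          a \<leftarrow> pol_a G \<phi> (m, x, SAC, z);
          return_pmf (m, x, SAC, Some (z, a))
        })
   }"

fun submitted :: "('task, 'u, 'out) decision \<Rightarrow> 'out" where
  "submitted (m, x, y, None) = x"
| "submitted (m, x, y, Some (z, KEEP)) = x"
| "submitted (m, x, y, Some (z, REVISE)) = z"

definition next_state ::
  "('task, 'u, 'out, 'p, 'q) game \<Rightarrow> ('task, 'u, 'out) decision \<Rightarrow> ('task, 'u, 'out) state" where
  "next_state G d = (case d of ((task, u, os), _) \<Rightarrow>
     (task, next_unit G d (submitted d), os @ [submitted d]))"

primrec play_pmf ::
  "('task, 'u, 'out, 'p, 'q) game \<Rightarrow> 'p \<Rightarrow> 'q \<Rightarrow> nat \<Rightarrow> ('task, 'u, 'out) state \<Rightarrow>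
    ('task, 'u, 'out) trajectory pmf" where
  "play_pmf G \<phi> \<theta> 0 m = return_pmf []"
| "play_pmf G \<phi> \<theta> (Suc n) m = do {
     d \<leftarrow> decision_pmf G \<phi> \<theta> m;
     ds \<leftarrow> play_pmf G \<phi> \<theta> n (next_state G d);
     return_pmf (d # ds)
   }"

definition trajectory_pmf ::
  "('task, 'u, 'out, 'p, 'q) game \<Rightarrow> 'p \<Rightarrow> 'q \<Rightarrow> ('task, 'u, 'out) trajectory pmf" where
  "trajectory_pmf G \<phi> \<theta> = do {
     task \<leftarrow> tasks G;
     play_pmf G \<phi> \<theta> (horizon G) (task, first_unit G task, [])
   }"

fun verifier_reward ::
  "('task, 'u, 'out, 'p, 'q) game \<Rightarrow> ('task, 'u, 'out) state \<Rightarrow> 'out \<Rightarrow> verdict \<Rightarrow> real" where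
  "verifier_reward G m x SAC = 1 - of_bool (correct G m x)"
| "verifier_reward G m x NS = 1 - (1 - of_bool (correct G m x))"

fun generator_reward ::
  "('task, 'u, 'out, 'p, 'q) game \<Rightarrow> ('task, 'u, 'out) state \<Rightarrow> 'out \<Rightarrow> 'out \<Rightarrow> choice \<Rightarrow> real" where
  "generator_reward G m x z KEEP = of_bool (correct G m x)"
| "generator_reward G m x z REVISE = of_bool (correct G m z)"

definition verifier_return ::
  "('task, 'u, 'out, 'p, 'q) game \<Rightarrow> ('task, 'u, 'out) trajectory \<Rightarrow> real" where
  "verifier_return G \<tau> = (\<Sum>(m, x, y, r)\<leftarrow>\<tau>. verifier_reward G m x y)"

definition generator_return ::
  "('task, 'u, 'out, 'p, 'q) game \<Rightarrow> ('task, 'u, 'out) trajectory \<Rightarrow> real" where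
  "generator_return G \<tau> =
     (\<Sum>(m, x, y, r)\<leftarrow>\<tau>. case r of None \<Rightarrow> 0 | Some (z, a) \<Rightarrow> generator_reward G m x z a)"

definition grpo_advantage :: "real \<Rightarrow> 'a set \<Rightarrow> ('a \<Rightarrow> real) \<Rightarrow> 'a \<Rightarrow> real" where
  "grpo_advantage \<epsilon> A R a =
     (let \<mu> = (\<Sum>j\<in>A. R j) / card A
      in (R a - \<mu>) / (sqrt ((\<Sum>j\<in>A. (R j - \<mu>)\<^sup>2) / card A) + \<epsilon>))"

text \<open>\<open>KL_divergence b M N\<close> is the divergence of \<open>N\<close> from \<open>M\<close>, so the reference policy comes first.
  The library value is the usual one when \<open>p\<close> is dominated by \<open>q\<close> and the divergence is finite;
  otherwise it is a real number instead of infinity.\<close>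

definition kl_pmf :: "'a pmf \<Rightarrow> 'a pmf \<Rightarrow> real" where
  "kl_pmf p q = KL_divergence (exp 1) (measure_pmf q) (measure_pmf p)"

text \<open>The contexts in which each policy is consulted during a decision (none for the revision and
  choice policies off the SAC branch).\<close>

fun contexts_v :: "('task, 'u, 'out) decision \<Rightarrow> (('task, 'u, 'out) state \<times> 'out) list" where
  "contexts_v (m, x, y, r) = [(m, x)]"

fun contexts_x :: "('task, 'u, 'out) decision \<Rightarrow> ('task, 'u, 'out) state list" where
  "contexts_x (m, x, y, r) = [m]"

fun contexts_z ::
  "('task, 'u, 'out) decision \<Rightarrow> (('task, 'u, 'out) state \<times> 'out \<times> verdict) list" where
  "contexts_z (m, x, y, None) = []"
| "contexts_z (m, x, y, Some (z, a)) = [(m, x, y)]"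

fun contexts_a ::
  "('task, 'u, 'out) decision \<Rightarrow> (('task, 'u, 'out) state \<times> 'out \<times> verdict \<times> 'out) list" where
  "contexts_a (m, x, y, None) = []"
| "contexts_a (m, x, y, Some (z, a)) = [(m, x, y, z)]"

text \<open>Like the returns, the KL terms are summed over the decisions of a trajectory.\<close>

definition expected_kl ::
  "('task, 'u, 'out) trajectory pmf \<Rightarrow> (('task, 'u, 'out) decision \<Rightarrow> 'c list) \<Rightarrow>
    ('c \<Rightarrow> 'a pmf) \<Rightarrow> ('c \<Rightarrow> 'a pmf) \<Rightarrow> real" where
  "expected_kl P ctx \<pi> \<rho> =
     measure_pmf.expectation P (\<lambda>\<tau>. \<Sum>d\<leftarrow>\<tau>. \<Sum>I\<leftarrow>ctx d. kl_pmf (\<pi> I) (\<rho> I))"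

definition verifier_objective ::
  "('task, 'u, 'out, 'p, 'q) game \<Rightarrow> 'q \<Rightarrow> 'p \<Rightarrow> real" where
  "verifier_objective G \<theta> \<phi> =
     (let P = trajectory_pmf G \<phi> \<theta> in
        measure_pmf.expectation P (verifier_return G)
        - beta_v G * expected_kl P contexts_v (pol_v G \<theta>) (ref_v G))"

definition generator_objective ::
  "('task, 'u, 'out, 'p, 'q) game \<Rightarrow> 'p \<Rightarrow> 'q \<Rightarrow> real" where
  "generator_objective G \<phi> \<theta> =
     (let P = trajectory_pmf G \<phi> \<theta> in
        measure_pmf.expectation P (generator_return G)
        - (beta_x G * expected_kl P contexts_x (pol_x G \<phi>) (ref_x G)
           + beta_z G * expected_kl P contexts_z (pol_z G \<phi>) (ref_z G)
           + beta_a G * expected_kl P contexts_a (pol_a G \<phi>) (ref_a G)))"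

definition grad :: "('a::real_inner \<Rightarrow> real) \<Rightarrow> 'a \<Rightarrow> 'a" where
  "grad f x = (THE D. GDERIV f x :> D)"

definition C1_lipschitz_gradient_on :: "'a::real_inner set \<Rightarrow> ('a \<Rightarrow> real) \<Rightarrow> bool" where
  "C1_lipschitz_gradient_on U f \<longleftrightarrow>
     (\<forall>x\<in>U. \<exists>D. GDERIV f x :> D) \<and> continuous_on U (grad f) \<and> (\<exists>L. L-lipschitz_on U (grad f))"

definition grad_generator ::
  "('task, 'u, 'out, 'p::real_inner, 'q) game \<Rightarrow> 'p \<Rightarrow> 'q \<Rightarrow> 'p" where
  "grad_generator G \<phi> \<theta> = grad (\<lambda>\<phi>'. generator_objective G \<phi>' \<theta>) \<phi>"

definition grad_verifier ::
  "('task, 'u, 'out, 'p, 'q::real_inner) game \<Rightarrow> 'q \<Rightarrow> 'p \<Rightarrow> 'q" where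
  "grad_verifier G \<theta> \<phi> = grad (\<lambda>\<theta>'. verifier_objective G \<theta>' \<phi>) \<theta>"

definition game_field ::
  "('task, 'u, 'out, 'p::real_inner, 'q::real_inner) game \<Rightarrow> 'p \<times> 'q \<Rightarrow> 'p \<times> 'q" where
  "game_field G = (\<lambda>(\<phi>, \<theta>). (grad_generator G \<phi> \<theta>, grad_verifier G \<theta> \<phi>))"

definition ode_solution ::
  "'a::real_normed_vector set \<Rightarrow> ('a \<Rightarrow> 'a) \<Rightarrow> 'a \<Rightarrow> real set \<Rightarrow> (real \<Rightarrow> 'a) \<Rightarrow> bool" where
  "ode_solution U F x I y \<longleftrightarrow>
     y 0 = x \<and> (\<forall>h\<in>I. y h \<in> U \<and> (y has_vector_derivative F (y h)) (at h within I))"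

text \<open>The flow of \<open>F\<close> on \<open>U\<close> may be incomplete: \<open>flow U F h x\<close> is meaningful only if the solution
  through \<open>x\<close> exists on \<open>{0..h}\<close> and is unique (as for locally Lipschitz \<open>F\<close>).\<close>

definition flow ::
  "'a::real_normed_vector set \<Rightarrow> ('a \<Rightarrow> 'a) \<Rightarrow> real \<Rightarrow> 'a \<Rightarrow> 'a" where
  "flow U F h x = (THE z. \<exists>y. ode_solution U F x {0..h} y \<and> y h = z)"

text \<open>Since the flow may be incomplete, the definition also demands that, for every \<open>H\<close>, the flow is
  defined up to time \<open>H\<close> from \<open>X s\<close> for all large \<open>s\<close>.\<close>

definition asymptotic_pseudotrajectory ::
  "'a::real_normed_vector set \<Rightarrow> ('a \<Rightarrow> 'a) \<Rightarrow> (real \<Rightarrow> 'a) \<Rightarrow> bool" where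
  "asymptotic_pseudotrajectory U F X \<longleftrightarrow>
     continuous_on {0..} X \<and>
     (\<forall>H>0. (\<forall>\<^sub>F s in at_top. \<exists>y. ode_solution U F (X s) {0..H} y) \<and>
       ((\<lambda>s. SUP h\<in>{0..H}. ennreal (norm (X (s + h) - flow U F h (X s)))) \<longlongrightarrow> 0) at_top)"

text \<open>Lyapunov stability together with local attractivity; \<open>F p = 0\<close> is not part of the definition.\<close>

definition asymptotically_stable ::
  "'a::real_normed_vector set \<Rightarrow> ('a \<Rightarrow> 'a) \<Rightarrow> 'a \<Rightarrow> bool" where
  "asymptotically_stable U F p \<longleftrightarrow>
     (\<forall>\<epsilon>>0. \<exists>\<delta>>0. \<forall>x\<in>ball p \<delta>. \<exists>y. ode_solution U F x {0..} y \<and> (\<forall>h\<ge>0. y h \<in> ball p \<epsilon>)) \<and>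
     (\<exists>\<delta>>0. \<forall>x\<in>ball p \<delta>. \<exists>y. ode_solution U F x {0..} y \<and> (y \<longlongrightarrow> p) at_top)"

text \<open>Training iterations are numbered from \<open>1\<close>.\<close>

definition step_time :: "(nat \<Rightarrow> real) \<Rightarrow> nat \<Rightarrow> real" where
  "step_time \<eta> t = (\<Sum>i\<in>{1..<t}. \<eta> i)"

definition interpolation ::
  "(nat \<Rightarrow> real) \<Rightarrow> (nat \<Rightarrow> 'a::real_vector) \<Rightarrow> real \<Rightarrow> 'a" where
  "interpolation \<eta> w s =
     (let t = (GREATEST t. 1 \<le> t \<and> step_time \<eta> t \<le> s)
      in w t + ((s - step_time \<eta> t) / \<eta> t) *\<^sub>R (w (Suc t) - w t))"

definition limit_points :: "(nat \<Rightarrow> 'a::topological_space) \<Rightarrow> 'a set" where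
  "limit_points w = {p. \<exists>r. strict_mono r \<and> (w \<circ> r) \<longlonglongrightarrow> p}"

text \<open>The library has conditional expectations of real functions only, hence the coordinates.\<close>

definition martingale_differences ::
  "'w measure \<Rightarrow> (nat \<Rightarrow> 'w measure) \<Rightarrow> (nat \<Rightarrow> 'w \<Rightarrow> 'a::euclidean_space) \<Rightarrow> bool" where
  "martingale_differences M \<F> \<xi> \<longleftrightarrow>
     (\<forall>t\<ge>1. \<xi> (Suc t) \<in> borel_measurable (\<F> (Suc t)) \<and> integrable M (\<xi> (Suc t)) \<and>
        (\<forall>e\<in>Basis. AE \<omega> in M. real_cond_exp M (\<F> t) (\<lambda>\<omega>. \<xi> (Suc t) \<omega> \<bullet> e) \<omega> = 0))"

definition bounded_second_moments ::
  "'w measure \<Rightarrow> (nat \<Rightarrow> 'w \<Rightarrow> 'a::euclidean_space) \<Rightarrow> bool" where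
  "bounded_second_moments M \<xi> \<longleftrightarrow>
     (\<exists>C. \<forall>t\<ge>1. integrable M (\<lambda>\<omega>. (norm (\<xi> (Suc t) \<omega>))\<^sup>2) \<and>
        (LINT \<omega>|M. (norm (\<xi> (Suc t) \<omega>))\<^sup>2) \<le> C)"

definition visits :: "verdict \<Rightarrow> ('task, 'u, 'out) trajectory list \<Rightarrow> bool" where
  "visits v B \<longleftrightarrow> (\<exists>\<tau>\<in>set B. \<exists>(m, x, y, r)\<in>set \<tau>. y = v)"

end

theory Submission
  imports Defs
begin

text \<open>Rewritten as an Euler scheme for the game field, the alternating iteration carries three
  errors: the martingale noise, whose weighted sums converge almost surely because
  \<open>\<Sum>\<eta>\<^sub>t\<^sup>2 < \<infinity>\<close>; the absolutely summable bias; and the difference between alternating and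
  simultaneous updates, which is \<open>\<eta>\<^sub>t\<close> times a null sequence. Over a time window of bounded length
  all three become negligible, so the interpolation eventually satisfies the integral equation of the
  ODE on such windows up to an arbitrarily small defect, and Gronwall's inequality compares it with the flow.
  Stationarity uses Lyapunov stability only: the solution through a point where the field does not
  vanish leaves every small neighbourhood of that point.\<close>


section \<open>Ordinary differential equations with a Lipschitz field\<close>

text \<open>The field is Lipschitz on the open set \<open>U\<close> only, and its flow there may be
  incomplete, so the existence of a solution on \<open>{0..H}\<close> from \<open>X s\<close> is
  part of what has to be proved. The field is therefore extended to a globally Lipschitz one; the
  solution for the extension cannot leave \<open>U\<close>, because it follows the interpolation,
  which ends up within any given distance of the compact set. The affine pieces themselves may leave
  the compact set, which need not be convex; only the vanishing of the increments keeps them close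
  to it. The only probabilistic work is the convergence of the noise series; the rest concerns one
  fixed sequence of iterates. That convergence need not be absolute, so noise has to be summed as
  vectors before norms are taken. Step sizes may be zero, so several iterates can share one
  time.\<close>

text \<open>McShane's formula: an infimum of the L-Lipschitz functions
  \<open>\<lambda>x. f u + L * dist x u\<close> is again L-Lipschitz, and at a point of
  \<open>U\<close> the infimum is attained at the point itself. The empty set is split off because
  the infimum over it carries no information.\<close>

lemma real_lipschitz_extension:
  fixes f :: "'a::metric_space \<Rightarrow> real"
  assumes f: "L-lipschitz_on U f"
  obtains g where "L-lipschitz_on UNIV g" and "\<And>x. x \<in> U \<Longrightarrow> g x = f x"
proof (cases "U = {}")
  case True
  have "L-lipschitz_on UNIV (\<lambda>x. 0 :: real)"
    using lipschitz_on_nonneg[OF f] by (intro lipschitz_onI) auto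
  then show ?thesis using that True by auto
next
  case False
  define g where "g x = (INF u\<in>U. f u + L * dist x u)" for x
  have L: "0 \<le> L" by (rule lipschitz_on_nonneg[OF f])
  have fL: "f x \<le> f y + L * dist x y" if "x \<in> U" "y \<in> U" for x y
    using lipschitz_onD[OF f that] by (auto simp: dist_real_def)
  have lower: "f v - L * dist x v \<le> f u + L * dist x u" if "u \<in> U" "v \<in> U" for u v x
  proof -
    have "L * dist v u \<le> L * (dist x v + dist x u)"
      using L by (intro mult_left_mono) (auto simp: dist_triangle3)
    then show ?thesis using fL[OF that(2,1)] by (simp add: algebra_simps)
  qed
  have bdd: "bdd_below ((\<lambda>u. f u + L * dist x u) ` U)" for x
  proof -
    obtain v where "v \<in> U" using False by auto
    then show ?thesis by (intro bdd_belowI2[of _ "f v - L * dist x v"] lower)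
  qed
  have gle: "g x \<le> g y + L * dist x y" for x y
  proof -
    have "g x - L * dist x y \<le> g y"
      unfolding g_def[of y]
    proof (rule cINF_greatest[OF False])
      fix u assume u: "u \<in> U"
      have "g x \<le> f u + L * dist x u"
        unfolding g_def by (rule cINF_lower[OF bdd u])
      moreover have "L * dist x u \<le> L * (dist x y + dist y u)"
        using L by (intro mult_left_mono dist_triangle)
      ultimately show "g x - L * dist x y \<le> f u + L * dist y u"
        by (simp add: algebra_simps)
    qed
    then show ?thesis by simp
  qed
  have "L-lipschitz_on UNIV g"
  proof (rule lipschitz_onI[OF _ L])
    fix x y show "dist (g x) (g y) \<le> L * dist x y"
      using gle[of x y] gle[of y x] by (auto simp: dist_real_def dist_commute abs_le_iff)
  qed
  moreover have "g x = f x" if x: "x \<in> U" for x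
  proof (rule antisym)
    show "g x \<le> f x"
      using cINF_lower[OF bdd x, of x] by (simp add: g_def)
    show "f x \<le> g x"
      unfolding g_def by (rule cINF_greatest[OF False]) (use fL[OF x] in auto)
  qed
  ultimately show ?thesis by (rule that)
qed

text \<open>McShane's extension is applied to each coordinate. This costs a factor
  \<open>DIM('b)\<close> in the constant, which is harmless: the constant only enters through
  Gronwall factors and null sequences.\<close>

lemma euclidean_lipschitz_extension:
  fixes f :: "'a::metric_space \<Rightarrow> 'b::euclidean_space"
  assumes f: "L-lipschitz_on U f"
  obtains g L' where "L'-lipschitz_on UNIV g" and "\<And>x. x \<in> U \<Longrightarrow> g x = f x"
proof -
  have L: "0 \<le> L" by (rule lipschitz_on_nonneg[OF f])
  have "\<exists>g. L-lipschitz_on UNIV g \<and> (\<forall>x\<in>U. g x = f x \<bullet> b)" if b: "b \<in> Basis" for b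
  proof -
    have "L-lipschitz_on U (\<lambda>x. f x \<bullet> b)"
    proof (rule lipschitz_onI[OF _ L])
      fix x y assume xy: "x \<in> U" "y \<in> U"
      have "\<bar>(f x - f y) \<bullet> b\<bar> \<le> norm (f x - f y)" by (rule Basis_le_norm[OF b])
      then show "dist (f x \<bullet> b) (f y \<bullet> b) \<le> L * dist x y"
        using lipschitz_onD[OF f xy] by (simp add: dist_real_def inner_diff_left dist_norm[of "f x"])
    qed
    then show ?thesis by (rule real_lipschitz_extension) blast
  qed
  then obtain g where g: "\<And>b. b \<in> Basis \<Longrightarrow> L-lipschitz_on UNIV (g b)"
    and gf: "\<And>b x. b \<in> Basis \<Longrightarrow> x \<in> U \<Longrightarrow> g b x = f x \<bullet> b"
    by metis
  define h where "h x = (\<Sum>b\<in>Basis. g b x *\<^sub>R b)" for x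
  have "(real DIM('b) * L)-lipschitz_on UNIV h"
  proof (rule lipschitz_onI)
    fix x y
    have "norm (h x - h y) = norm (\<Sum>b\<in>Basis. (g b x - g b y) *\<^sub>R b)"
      by (simp add: h_def sum_subtractf scaleR_diff_left)
    also have "\<dots> \<le> (\<Sum>b\<in>Basis. norm ((g b x - g b y) *\<^sub>R b))"
      by (rule norm_sum)
    also have "\<dots> \<le> (\<Sum>b\<in>(Basis::'b set). L * dist x y)"
    proof (rule sum_mono)
      fix b :: 'b assume b: "b \<in> Basis"
      then show "norm ((g b x - g b y) *\<^sub>R b) \<le> L * dist x y"
        using lipschitz_onD[OF g[OF b], of x y] by (simp add: dist_real_def)
    qed
    finally show "dist (h x) (h y) \<le> real DIM('b) * L * dist x y" by (simp add: dist_norm)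
  qed (use L in simp)
  moreover have "h x = f x" if "x \<in> U" for x
    using that by (simp add: h_def gf euclidean_representation)
  ultimately show ?thesis by (rule that)
qed

text \<open>The assumed inequality says exactly that the derivative of
  \<open>exp (- L * s) * (a + L * integral {0..s} u)\<close> is nonpositive; its value at 0 is
  \<open>a\<close>.\<close>

lemma gronwall_integral:
  fixes u :: "real \<Rightarrow> real"
  assumes u: "continuous_on {0..H} u" and L: "0 \<le> L"
    and le: "\<And>h. h \<in> {0..H} \<Longrightarrow> u h \<le> a + L * integral {0..h} u"
    and h: "h \<in> {0..H}"
  shows "u h \<le> a * exp (L * h)"
proof -
  define v where "v s = exp (- L * s) * (a + L * integral {0..s} u)" for s
  have D: "((\<lambda>s. integral {0..s} u) has_real_derivative u s) (at s within {0..H})" if "s \<in> {0..H}" for s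
    using integral_has_vector_derivative[OF u that] by (simp add: has_real_derivative_iff_has_vector_derivative)
  have Dv: "(v has_real_derivative exp (- L * s) * L * (u s - (a + L * integral {0..s} u)))
      (at s within {0..H})" if "s \<in> {0..H}" for s
    unfolding v_def
    by (rule derivative_eq_intros D[OF that] refl | simp)+ (simp add: algebra_simps)
  have cv: "continuous_on {0..h} v"
    by (rule continuous_on_subset[OF DERIV_continuous_on[OF Dv]]) (use h in auto)
  have "v h \<le> v 0"
  proof (rule DERIV_nonpos_imp_decreasing_open[OF _ _ cv])
    fix s assume s: "0 < s" "s < h"
    have "(v has_real_derivative exp (- L * s) * L * (u s - (a + L * integral {0..s} u))) (at s)"
      using Dv[of s] s h by (simp add: at_within_Icc_at)
    moreover have "exp (- L * s) * L * (u s - (a + L * integral {0..s} u)) \<le> 0"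
      using le[of s] s h L by (intro mult_nonneg_nonpos) auto
    ultimately show "\<exists>y. (v has_real_derivative y) (at s) \<and> y \<le> 0" by blast
  qed (use h in auto)
  then have "exp (L * h) * v h \<le> exp (L * h) * a"
    by (simp add: v_def)
  also have "exp (L * h) * v h = a + L * integral {0..h} u"
    by (simp add: v_def exp_minus)
  finally show ?thesis using le[OF h] by (simp add: mult.commute)
qed

text \<open>The approximate solution is described by an integral equation with defect \<Delta> and
  not by a derivative, since it will be a piecewise affine path with corners.\<close>

lemma approximate_solution_close:
  fixes F :: "'a::euclidean_space \<Rightarrow> 'a"
  assumes F: "L-lipschitz_on UNIV F"
    and X: "continuous_on {0..H} X" and y: "continuous_on {0..H} y"
    and X_eq: "\<And>h. h \<in> {0..H} \<Longrightarrow> norm (X h - x - integral {0..h} (\<lambda>s. F (X s))) \<le> \<Delta>"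
    and y_eq: "\<And>h. h \<in> {0..H} \<Longrightarrow> y h = x + integral {0..h} (\<lambda>s. F (y s))"
    and h: "h \<in> {0..H}"
  shows "norm (X h - y h) \<le> \<Delta> * exp (L * h)"
proof (rule gronwall_integral[OF _ lipschitz_on_nonneg[OF F] _ h])
  show cn: "continuous_on {0..H} (\<lambda>h. norm (X h - y h))"
    by (intro continuous_intros X y)
  fix h assume h: "h \<in> {0..H}"
  have FU: "continuous_on UNIV F" by (rule lipschitz_on_continuous_on[OF F])
  have sub: "{0..h} \<subseteq> {0..H}" using h by auto
  have i: "(\<lambda>s. F (X s)) integrable_on {0..h}" "(\<lambda>s. F (y s)) integrable_on {0..h}"
    by (intro integrable_continuous_real continuous_on_compose2[OF FU]
        continuous_on_subset[OF X sub] continuous_on_subset[OF y sub]; simp)+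
  have "norm (integral {0..h} (\<lambda>s. F (X s)) - integral {0..h} (\<lambda>s. F (y s)))
      = norm (integral {0..h} (\<lambda>s. F (X s) - F (y s)))"
    using i by (simp add: integral_diff)
  also have "\<dots> \<le> integral {0..h} (\<lambda>s. L * norm (X s - y s))"
  proof (rule integral_norm_bound_integral)
    show "(\<lambda>s. F (X s) - F (y s)) integrable_on {0..h}" by (intro integrable_diff i)
    show "(\<lambda>s. L * norm (X s - y s)) integrable_on {0..h}"
      by (intro integrable_continuous_real continuous_intros
          continuous_on_subset[OF X sub] continuous_on_subset[OF y sub])
  qed (use lipschitz_onD[OF F] in \<open>auto simp: dist_norm\<close>)
  finally have "norm (integral {0..h} (\<lambda>s. F (X s)) - integral {0..h} (\<lambda>s. F (y s)))
      \<le> L * integral {0..h} (\<lambda>s. norm (X s - y s))" by simp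
  moreover have "X h - y h = (X h - x - integral {0..h} (\<lambda>s. F (X s)))
      + (integral {0..h} (\<lambda>s. F (X s)) - integral {0..h} (\<lambda>s. F (y s)))"
    using y_eq[OF h] by simp
  ultimately show "norm (X h - y h) \<le> \<Delta> + L * integral {0..h} (\<lambda>s. norm (X s - y s))"
    using X_eq[OF h] by (smt (verit) norm_triangle_ineq)
qed

text \<open>Picard iteration on the whole of \<open>{0..H}\<close> at once: for \<open>z s = exp (- K s) y s\<close> with
  \<open>K = 2 L + 1\<close> the Picard operator contracts the supremum norm by \<open>L / K\<close>.\<close>

lemma integral_equation_solution_exists:
  fixes F :: "'a::euclidean_space \<Rightarrow> 'a"
  assumes F: "L-lipschitz_on UNIV F" and H: "0 \<le> H"
  obtains y :: "real \<Rightarrow> 'a" where "continuous_on {0..H} y"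
    and "\<And>h. h \<in> {0..H} \<Longrightarrow> y h = x + integral {0..h} (\<lambda>s. F (y s))"
proof -
  define K where "K = 2 * L + 1"
  have L: "0 \<le> L" by (rule lipschitz_on_nonneg[OF F])
  then have K: "0 < K" by (simp add: K_def)
  have FU: "continuous_on UNIV F" by (rule lipschitz_on_continuous_on[OF F])
  \<comment> \<open>Clamping time to \<open>{0..H}\<close> extends the Picard image constantly to
    the whole line, so that it is an element of the complete space of bounded continuous
    functions.\<close>
  define c where "c h = max 0 (min H h)" for h
  have c: "c h \<in> {0..H}" for h using H by (auto simp: c_def)
  have cc: "continuous_on UNIV c" unfolding c_def by (intro continuous_intros)
  define I where "I z h = integral {0..h} (\<lambda>s. F (exp (K * s) *\<^sub>R apply_bcontfun z s))" for z h
  define P where "P z h = exp (- K * c h) *\<^sub>R (x + I z (c h))" for z h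
  have ci: "continuous_on A (\<lambda>s. F (exp (K * s) *\<^sub>R apply_bcontfun z s))" for A z
    by (intro continuous_on_compose2[OF FU] continuous_intros) auto
  have cI: "continuous_on {0..H} (I z)" for z
    unfolding I_def by (intro indefinite_integral_continuous_1 integrable_continuous_real ci)
  have cP: "continuous_on UNIV (P z)" for z
    unfolding P_def
    by (intro continuous_intros cc continuous_on_compose2[OF cI cc]) (use c in auto)
  have P: "P z \<in> bcontfun" for z
  proof -
    have "bounded ((\<lambda>h. exp (- K * h) *\<^sub>R (x + I z h)) ` {0..H})"
      by (intro compact_imp_bounded compact_continuous_image continuous_intros cI) auto
    moreover have "range (P z) \<subseteq> (\<lambda>h. exp (- K * h) *\<^sub>R (x + I z h)) ` {0..H}"
      using c by (auto simp: P_def)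
    ultimately have "bounded (range (P z))" by (rule bounded_subset)
    then show ?thesis using cP by (simp add: bcontfun_def)
  qed
  have contr: "dist (Bcontfun (P z1)) (Bcontfun (P z2)) \<le> L / K * dist z1 z2" for z1 z2
  proof (rule dist_bound)
    fix h
    let ?h = "c h"
    have h: "0 \<le> ?h" using c[of h] by simp
    have "norm (I z1 ?h - I z2 ?h) = norm (integral {0..?h} (\<lambda>s.
        F (exp (K * s) *\<^sub>R apply_bcontfun z1 s) - F (exp (K * s) *\<^sub>R apply_bcontfun z2 s)))"
      unfolding I_def by (subst integral_diff) (auto intro!: integrable_continuous_real ci)
    also have "\<dots> \<le> integral {0..?h} (\<lambda>s. exp (K * s) * (L * dist z1 z2))"
    proof (rule integral_norm_bound_integral)
      fix s
      have "norm (F (exp (K * s) *\<^sub>R apply_bcontfun z1 s) - F (exp (K * s) *\<^sub>R apply_bcontfun z2 s))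
          \<le> L * dist (exp (K * s) *\<^sub>R apply_bcontfun z1 s) (exp (K * s) *\<^sub>R apply_bcontfun z2 s)"
        using lipschitz_onD[OF F] by (simp add: dist_norm)
      also have "\<dots> = L * (exp (K * s) * dist (apply_bcontfun z1 s) (apply_bcontfun z2 s))"
        by (simp add: dist_norm scaleR_diff_right[symmetric])
      also have "\<dots> \<le> L * (exp (K * s) * dist z1 z2)"
        using L by (intro mult_left_mono dist_bounded) auto
      finally show "norm (F (exp (K * s) *\<^sub>R apply_bcontfun z1 s) - F (exp (K * s) *\<^sub>R apply_bcontfun z2 s))
          \<le> exp (K * s) * (L * dist z1 z2)" by (simp add: mult_ac)
    qed (auto intro!: integrable_continuous_real continuous_intros ci integrable_diff)
    \<comment> \<open>Here the weight pays off: the integral is at most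
      \<open>exp (K * ?h) / K\<close>, and the factor \<open>exp (- K * ?h)\<close> in
      \<open>P\<close> removes the growth, leaving \<open>L / K\<close> whatever the length of the
      interval.\<close>
    also have "\<dots> = (exp (K * ?h) - 1) / K * (L * dist z1 z2)"
    proof -
      have "((\<lambda>s. exp (K * s)) has_integral exp (K * ?h) / K - exp (K * 0) / K) {0..?h}"
        by (rule fundamental_theorem_of_calculus[OF h])
          (use K in \<open>auto intro!: derivative_eq_intros
            simp: has_real_derivative_iff_has_vector_derivative[symmetric]\<close>)
      then have "integral {0..?h} (\<lambda>s. exp (K * s)) = (exp (K * ?h) - 1) / K"
        by (simp add: integral_unique diff_divide_distrib)
      then show ?thesis by simp
    qed
    also have "\<dots> \<le> exp (K * ?h) * (L / K * dist z1 z2)"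
      using K L by (simp add: field_simps mult_right_mono)
    finally have "exp (- K * ?h) * norm (I z1 ?h - I z2 ?h) \<le> L / K * dist z1 z2"
      using K by (simp add: exp_minus field_simps)
    then show "dist (apply_bcontfun (Bcontfun (P z1)) h) (apply_bcontfun (Bcontfun (P z2)) h)
        \<le> L / K * dist z1 z2"
      by (simp add: Bcontfun_inverse[OF P] P_def dist_norm scaleR_diff_right[symmetric])
  qed
  have "\<exists>!z. Bcontfun (P z) = z"
    by (rule banach_fix_type[of "L / K"]) (use L K contr in \<open>auto simp: K_def\<close>)
  then obtain z where z: "Bcontfun (P z) = z" by blast
  define y where "y h = exp (K * h) *\<^sub>R apply_bcontfun z h" for h
  have "y h = x + integral {0..h} (\<lambda>s. F (y s))" if h: "h \<in> {0..H}" for h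
  proof -
    have "c h = h" using h by (auto simp: c_def)
    have "apply_bcontfun z h = P z h"
      using z Bcontfun_inverse[OF P] by metis
    then show ?thesis by (simp add: y_def P_def I_def \<open>c h = h\<close> exp_minus)
  qed
  moreover have "continuous_on {0..H} y"
    unfolding y_def by (intro continuous_intros) auto
  ultimately show ?thesis by (rule that[rotated])
qed

section \<open>Uniqueness of solutions and the value of the flow\<close>

lemma ode_solution_integral_equation:
  fixes y :: "real \<Rightarrow> 'a::euclidean_space"
  assumes y: "ode_solution U F x {0..H} y" and h: "h \<in> {0..H}"
  shows "y h = x + integral {0..h} (\<lambda>s. F (y s))"
proof -
  have "((\<lambda>s. F (y s)) has_integral y h - y 0) {0..h}"
  proof (rule fundamental_theorem_of_calculus)
    fix s assume "s \<in> {0..h}"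
    then have "(y has_vector_derivative F (y s)) (at s within {0..H})"
      using y h by (auto simp: ode_solution_def)
    then show "(y has_vector_derivative F (y s)) (at s within {0..h})"
      by (rule has_vector_derivative_within_subset) (use h in auto)
  qed (use h in auto)
  then show ?thesis using y by (simp add: integral_unique ode_solution_def)
qed

text \<open>Solutions stay in \<open>U\<close>, so they also solve the equation of the globally
  Lipschitz extension; there one of them counts as an approximate solution with defect 0.\<close>

lemma ode_solution_unique:
  fixes F :: "'a::euclidean_space \<Rightarrow> 'a"
  assumes F: "L-lipschitz_on U F"
    and y1: "ode_solution U F x {0..H} y1" and y2: "ode_solution U F x {0..H} y2"
    and h: "h \<in> {0..H}"
  shows "y1 h = y2 h"
proof -
  obtain g L' where g: "L'-lipschitz_on UNIV g" and gF: "\<And>x. x \<in> U \<Longrightarrow> g x = F x"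
    using euclidean_lipschitz_extension[OF F] by metis
  have cont: "continuous_on {0..H} y" if "ode_solution U F x {0..H} y" for y
    using that by (intro continuous_on_vector_derivative) (auto simp: ode_solution_def)
  have sol: "y h = x + integral {0..h} (\<lambda>s. g (y s))"
    if y: "ode_solution U F x {0..H} y" and h: "h \<in> {0..H}" for y h
  proof -
    have "integral {0..h} (\<lambda>s. F (y s)) = integral {0..h} (\<lambda>s. g (y s))"
      by (rule integral_cong) (use y h gF in \<open>auto simp: ode_solution_def\<close>)
    then show "y h = x + integral {0..h} (\<lambda>s. g (y s))"
      using ode_solution_integral_equation[OF y h] by simp
  qed
  have "norm (y1 s - x - integral {0..s} (\<lambda>s. g (y1 s))) \<le> 0" if "s \<in> {0..H}" for s
    by (subst sol[OF y1 that]) simp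
  from approximate_solution_close[OF g cont[OF y1] cont[OF y2] this sol[OF y2] h]
  have "norm (y1 h - y2 h) \<le> 0 * exp (L' * h)" by simp
  then show ?thesis by simp
qed

text \<open>Uniqueness turns the definite description in \<open>flow\<close> into the value of a
  concrete solution. The solution has to be restricted first, because \<open>flow\<close> refers to
  the window that ends exactly at \<open>h\<close>.\<close>

lemma flow_eq:
  fixes F :: "'a::euclidean_space \<Rightarrow> 'a"
  assumes F: "L-lipschitz_on U F" and y: "ode_solution U F x {0..H} y" and h: "h \<in> {0..H}"
  shows "flow U F h x = y h"
proof -
  have y': "ode_solution U F x {0..h} y"
    unfolding ode_solution_def
  proof (intro conjI ballI)
    fix s assume "s \<in> {0..h}"
    then have s: "s \<in> {0..H}" using h by auto
    show "y s \<in> U" using y s by (auto simp: ode_solution_def)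
    have "(y has_vector_derivative F (y s)) (at s within {0..H})"
      using y s by (auto simp: ode_solution_def)
    then show "(y has_vector_derivative F (y s)) (at s within {0..h})"
      by (rule has_vector_derivative_within_subset) (use h in auto)
  qed (use y in \<open>simp add: ode_solution_def\<close>)
  show ?thesis
    unfolding flow_def
  proof (rule the_equality)
    fix z assume "\<exists>y. ode_solution U F x {0..h} y \<and> y h = z"
    then show "z = y h" using ode_solution_unique[OF F _ y', of _ h] h by auto
  qed (use y' in blast)
qed

text \<open>Shadowing: the solution of the extended field stays in \<open>U\<close> because the approximate
  solution stays well inside \<open>U\<close>.\<close>

lemma ode_solution_near_approximate_solution:
  fixes F :: "'a::euclidean_space \<Rightarrow> 'a"
  assumes g: "L-lipschitz_on UNIV g" and gF: "\<And>x. x \<in> U \<Longrightarrow> g x = F x" and H: "0 \<le> H"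
    and X: "continuous_on {0..H} X"
    and X_eq: "\<And>h. h \<in> {0..H} \<Longrightarrow> norm (X h - X 0 - integral {0..h} (\<lambda>s. g (X s))) \<le> \<Delta>"
    and X_ball: "\<And>h. h \<in> {0..H} \<Longrightarrow> cball (X h) (\<Delta> * exp (L * H)) \<subseteq> U"
  obtains y where "ode_solution U F (X 0) {0..H} y"
    and "\<And>h. h \<in> {0..H} \<Longrightarrow> norm (X h - y h) \<le> \<Delta> * exp (L * H)"
proof -
  obtain y where y: "continuous_on {0..H} y"
    and y_eq: "\<And>h. h \<in> {0..H} \<Longrightarrow> y h = X 0 + integral {0..h} (\<lambda>s. g (y s))"
    using integral_equation_solution_exists[OF g H] by metis
  have "0 \<le> norm (X 0 - X 0 - integral {0..0} (\<lambda>s. g (X s)))" by simp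
  also have "\<dots> \<le> \<Delta>" using X_eq[of 0] H by simp
  finally have \<Delta>: "0 \<le> \<Delta>" .
  have close: "norm (X h - y h) \<le> \<Delta> * exp (L * H)" if h: "h \<in> {0..H}" for h
  proof -
    have "norm (X h - y h) \<le> \<Delta> * exp (L * h)"
      by (rule approximate_solution_close[OF g X y X_eq y_eq h])
    also have "\<dots> \<le> \<Delta> * exp (L * H)"
      using \<Delta> h lipschitz_on_nonneg[OF g] by (intro mult_left_mono) (auto intro: mult_left_mono)
    finally show ?thesis .
  qed
  have y0: "y 0 = X 0" using y_eq[of 0] H by simp
  have yU: "y h \<in> U" if "h \<in> {0..H}" for h
    using X_ball[OF that] close[OF that] by (auto simp: dist_norm subset_eq)
  have cg: "continuous_on {0..H} (\<lambda>s. g (y s))"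
    by (rule continuous_on_compose2[OF lipschitz_on_continuous_on[OF g] y]) auto
  have "(y has_vector_derivative F (y h)) (at h within {0..H})" if h: "h \<in> {0..H}" for h
  proof -
    have "((\<lambda>u. X 0 + integral {0..u} (\<lambda>s. g (y s))) has_vector_derivative 0 + g (y h)) (at h within {0..H})"
      by (intro has_vector_derivative_add has_vector_derivative_const integral_has_vector_derivative cg h)
    then have "(y has_vector_derivative 0 + g (y h)) (at h within {0..H})"
      by (rule has_vector_derivative_transform[OF h, rotated]) (rule y_eq)
    then show ?thesis using gF[OF yU[OF h]] by simp
  qed
  then have "ode_solution U F (X 0) {0..H} y"
    using yU y0 by (simp add: ode_solution_def)
  then show ?thesis using close by (rule that)
qed

section \<open>Convergence of square-integrable martingale noise\<close>

text \<open>Orthogonality of a martingale difference to the past: under the integral,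
  \<open>D\<close> may be replaced by its conditional expectation. Boundedness of \<open>Z\<close>
  makes the product integrable.\<close>

lemma (in prob_space) integral_mult_martingale_difference:
  assumes G: "subalgebra M G" and Z: "Z \<in> borel_measurable G" and bound: "\<And>\<omega>. \<bar>Z \<omega>\<bar> \<le> c"
    and D: "integrable M D" and D0: "AE \<omega> in M. real_cond_exp M G D \<omega> = 0"
  shows "integrable M (\<lambda>\<omega>. Z \<omega> * D \<omega>)" and "(LINT \<omega>|M. Z \<omega> * D \<omega>) = 0"
proof -
  interpret finite_measure_subalgebra M G by unfold_locales (rule G)
  interpret sigma_finite_subalgebra M G
    by (rule finite_measure_subalgebra_is_sigma_finite) unfold_locales
  have ZM [measurable]: "Z \<in> borel_measurable M" by (rule measurable_from_subalg[OF G Z])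
  have [measurable]: "D \<in> borel_measurable M" using D by auto
  show i: "integrable M (\<lambda>\<omega>. Z \<omega> * D \<omega>)"
  proof (rule Bochner_Integration.integrable_bound)
    show "integrable M (\<lambda>\<omega>. c * D \<omega>)" using D by simp
    have "\<bar>Z \<omega>\<bar> * \<bar>D \<omega>\<bar> \<le> \<bar>c\<bar> * \<bar>D \<omega>\<bar>" for \<omega>
      using bound[of \<omega>] by (intro mult_right_mono) auto
    then show "AE \<omega> in M. norm (Z \<omega> * D \<omega>) \<le> norm (c * D \<omega>)" by (simp add: abs_mult)
  qed simp
  have "(LINT \<omega>|M. Z \<omega> * D \<omega>) = (LINT \<omega>|M. Z \<omega> * real_cond_exp M G D \<omega>)"
    by (rule real_cond_exp_intg(2)[symmetric, OF i Z]) simp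
  also have "\<dots> = (LINT \<omega>|M. 0)"
    using D0 by (intro integral_cong_AE) (auto simp: borel_measurable_cond_exp2)
  finally show "(LINT \<omega>|M. Z \<omega> * D \<omega>) = 0" by simp
qed

text \<open>Stopping at the first partial sum of modulus at least \<open>\<epsilon>\<close> makes the maximal inequality an
  instance of Markov's inequality.\<close>

primrec stopped_sum :: "real \<Rightarrow> (nat \<Rightarrow> 'w \<Rightarrow> real) \<Rightarrow> nat \<Rightarrow> 'w \<Rightarrow> real" where
  "stopped_sum \<epsilon> D 0 \<omega> = 0"
| "stopped_sum \<epsilon> D (Suc n) \<omega> =
     stopped_sum \<epsilon> D n \<omega> + (if \<bar>stopped_sum \<epsilon> D n \<omega>\<bar> < \<epsilon> then D n \<omega> else 0)"

text \<open>Once its modulus has reached \<epsilon>, the stopped sum no longer moves. A value below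
  \<epsilon> at time \<open>n\<close> thus shows that no stopping has occurred up to then.\<close>

lemma stopped_sum_before:
  assumes "\<bar>stopped_sum \<epsilon> D n \<omega>\<bar> < \<epsilon>" and "k \<le> n"
  shows "stopped_sum \<epsilon> D k \<omega> = (\<Sum>i<k. D i \<omega>) \<and> \<bar>stopped_sum \<epsilon> D k \<omega>\<bar> < \<epsilon>"
proof -
  have *: "\<bar>stopped_sum \<epsilon> D k \<omega>\<bar> < \<epsilon>" if "k \<le> n" for k
    using assms(1) that
  proof (induction n)
    case (Suc n)
    show ?case
    proof (cases "k = Suc n")
      case False
      then show ?thesis using Suc by (intro Suc.IH) (auto split: if_splits)
    qed (use Suc in simp)
  qed simp
  have "stopped_sum \<epsilon> D k \<omega> = (\<Sum>i<k. D i \<omega>)" using assms(2)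
  proof (induction k)
    case (Suc k)
    then show ?case using *[of k] by simp
  qed simp
  then show ?thesis using *[OF assms(2)] by simp
qed

lemma stopped_sum_reaches:
  assumes "k \<le> n" and "\<epsilon> \<le> \<bar>\<Sum>i<k. D i \<omega>\<bar>"
  shows "\<epsilon> \<le> \<bar>stopped_sum \<epsilon> D n \<omega>\<bar>"
  using stopped_sum_before[of \<epsilon> D n \<omega> k] assms by fastforce

locale square_integrable_differences = prob_space +
  fixes G :: "nat \<Rightarrow> 'a measure" and D :: "nat \<Rightarrow> 'a \<Rightarrow> real" and v :: "nat \<Rightarrow> real"
  assumes filt: "filtration (space M) G" and sub: "\<And>n. subalgebra M (G n)"
    and adapted: "\<And>n. D n \<in> borel_measurable (G (Suc n))"
    and square_integrable: "\<And>n. integrable M (\<lambda>\<omega>. (D n \<omega>)\<^sup>2)"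
    and second_moment: "\<And>n. (LINT \<omega>|M. (D n \<omega>)\<^sup>2) \<le> v n"
    and cond_exp: "\<And>n. AE \<omega> in M. real_cond_exp M (G n) (D n) \<omega> = 0"
begin

lemma D_measurable [measurable]: "D n \<in> borel_measurable M"
  by (rule measurable_from_subalg[OF sub adapted])

lemma D_integrable: "integrable M (D n)"
  by (rule square_integrable_imp_integrable[OF D_measurable square_integrable])

lemma filtration_mono: "i \<le> j \<Longrightarrow> subalgebra (G j) (G i)"
  using filt by (auto simp: filtration_def subalgebra_def)

lemma stopped_sum_adapted: "stopped_sum \<epsilon> D n \<in> borel_measurable (G n)"
proof (induction n)
  case (Suc n)
  have [measurable]: "stopped_sum \<epsilon> D n \<in> borel_measurable (G (Suc n))"
    by (rule measurable_from_subalg[OF filtration_mono Suc]) simp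
  note adapted[of n, measurable]
  show ?case by simp
qed simp

text \<open>With \<open>J\<close> the indicator of not having stopped, the square expands to
  \<open>T\<^sup>2 + 2 * J * T * D + J * D\<^sup>2\<close>, and the cross term integrates to 0.
  Stopping helps twice: it also makes \<open>J * T\<close> bounded, as the orthogonality lemma
  demands.\<close>

lemma stopped_sum_second_moment:
  "integrable M (\<lambda>\<omega>. (stopped_sum \<epsilon> D n \<omega>)\<^sup>2) \<and> (LINT \<omega>|M. (stopped_sum \<epsilon> D n \<omega>)\<^sup>2) \<le> (\<Sum>i<n. v i)"
proof (induction n)
  case (Suc n)
  define T where "T = stopped_sum \<epsilon> D n"
  define J where "J \<omega> = (if \<bar>T \<omega>\<bar> < \<epsilon> then 1 else 0 :: real)" for \<omega>
  have TG [measurable]: "T \<in> borel_measurable (G n)" unfolding T_def by (rule stopped_sum_adapted)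
  have [measurable]: "T \<in> borel_measurable M" by (rule measurable_from_subalg[OF sub TG])
  have JG: "J \<in> borel_measurable (G n)" unfolding J_def by simp
  have [measurable]: "J \<in> borel_measurable M" by (rule measurable_from_subalg[OF sub JG])
  have ZG: "(\<lambda>\<omega>. J \<omega> * T \<omega>) \<in> borel_measurable (G n)" using TG JG by simp
  note Z = integral_mult_martingale_difference[OF sub ZG _ D_integrable cond_exp, of "\<bar>\<epsilon>\<bar>"]
  have Z1: "integrable M (\<lambda>\<omega>. J \<omega> * T \<omega> * D n \<omega>)" and Z2: "(LINT \<omega>|M. J \<omega> * T \<omega> * D n \<omega>) = 0"
    by (rule Z; auto simp: J_def)+
  have J1: "integrable M (\<lambda>\<omega>. J \<omega> * (D n \<omega>)\<^sup>2)"
    by (rule Bochner_Integration.integrable_bound[OF square_integrable[of n]]) (auto simp: J_def)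
  have J2: "(LINT \<omega>|M. J \<omega> * (D n \<omega>)\<^sup>2) \<le> v n"
  proof -
    have "(LINT \<omega>|M. J \<omega> * (D n \<omega>)\<^sup>2) \<le> (LINT \<omega>|M. (D n \<omega>)\<^sup>2)"
      by (rule integral_mono[OF J1 square_integrable]) (auto simp: J_def)
    then show ?thesis using second_moment[of n] by simp
  qed
  have eq: "(stopped_sum \<epsilon> D (Suc n) \<omega>)\<^sup>2 = (T \<omega>)\<^sup>2 + 2 * (J \<omega> * T \<omega> * D n \<omega>) + J \<omega> * (D n \<omega>)\<^sup>2" for \<omega>
    by (simp add: T_def J_def power2_eq_square algebra_simps)
  show ?case
    unfolding eq using Suc Z1 Z2 J1 J2 by (simp add: T_def)
qed simp

text \<open>Kolmogorov's maximal inequality for martingale differences: the event forces the stopped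
  sum at time \<open>n\<close> to have modulus at least \<epsilon>.\<close>

lemma prob_partial_sums_large:
  assumes \<epsilon>: "0 < \<epsilon>"
  shows "prob {\<omega>\<in>space M. \<exists>k\<le>n. \<epsilon> \<le> \<bar>\<Sum>i<k. D i \<omega>\<bar>} \<le> (\<Sum>i<n. v i) / \<epsilon>\<^sup>2"
proof -
  have [measurable]: "stopped_sum \<epsilon> D n \<in> borel_measurable M"
    by (rule measurable_from_subalg[OF sub stopped_sum_adapted])
  have "prob {\<omega>\<in>space M. \<exists>k\<le>n. \<epsilon> \<le> \<bar>\<Sum>i<k. D i \<omega>\<bar>}
      \<le> prob {\<omega>\<in>space M. \<epsilon>\<^sup>2 \<le> (stopped_sum \<epsilon> D n \<omega>)\<^sup>2}"
  proof (rule finite_measure_mono)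
    show "{\<omega>\<in>space M. \<exists>k\<le>n. \<epsilon> \<le> \<bar>\<Sum>i<k. D i \<omega>\<bar>} \<subseteq> {\<omega>\<in>space M. \<epsilon>\<^sup>2 \<le> (stopped_sum \<epsilon> D n \<omega>)\<^sup>2}"
      using stopped_sum_reaches[of _ n \<epsilon> D] \<epsilon> by (auto simp: abs_le_square_iff[symmetric])
  qed simp
  also have "\<dots> \<le> (LINT \<omega>|M. (stopped_sum \<epsilon> D n \<omega>)\<^sup>2) / \<epsilon>\<^sup>2"
    by (rule integral_Markov_inequality_measure[where A = "{}"])
      (use stopped_sum_second_moment \<epsilon> in auto)
  also have "\<dots> \<le> (\<Sum>i<n. v i) / \<epsilon>\<^sup>2"
    using stopped_sum_second_moment by (intro divide_right_mono) auto
  finally show ?thesis .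
qed

lemma v_nonneg: "0 \<le> v n"
  using second_moment[of n] by (rule order_trans[rotated]) simp

text \<open>Continuity from below: the finite events increase, and the full series of
  \<open>v\<close> bounds all of them.\<close>

lemma prob_some_partial_sum_large:
  assumes \<epsilon>: "0 < \<epsilon>" and v: "summable v"
  shows "prob {\<omega>\<in>space M. \<exists>k. \<epsilon> \<le> \<bar>\<Sum>i<k. D i \<omega>\<bar>} \<le> (\<Sum>i. v i) / \<epsilon>\<^sup>2"
proof -
  define A where "A n = {\<omega>\<in>space M. \<exists>k\<le>n. \<epsilon> \<le> \<bar>\<Sum>i<k. D i \<omega>\<bar>}" for n
  have "(\<lambda>n. prob (A n)) \<longlonglongrightarrow> prob (\<Union>n. A n)"
    by (rule finite_Lim_measure_incseq) (auto simp: A_def incseq_def intro: order_trans)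
  moreover have "prob (A n) \<le> (\<Sum>i. v i) / \<epsilon>\<^sup>2" for n
  proof -
    have "prob (A n) \<le> (\<Sum>i<n. v i) / \<epsilon>\<^sup>2"
      unfolding A_def by (rule prob_partial_sums_large[OF \<epsilon>])
    also have "\<dots> \<le> (\<Sum>i. v i) / \<epsilon>\<^sup>2"
      by (intro divide_right_mono sum_le_suminf v) (auto simp: v_nonneg)
    finally show ?thesis .
  qed
  ultimately have "prob (\<Union>n. A n) \<le> (\<Sum>i. v i) / \<epsilon>\<^sup>2"
    by (intro LIMSEQ_le_const2) auto
  also have "(\<Union>n. A n) = {\<omega>\<in>space M. \<exists>k. \<epsilon> \<le> \<bar>\<Sum>i<k. D i \<omega>\<bar>}"
    by (auto simp: A_def)
  finally show ?thesis .
qed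

text \<open>Tails are again instances of the locale, which makes the maximal inequality available
  from every starting index.\<close>

lemma shift: "square_integrable_differences M (\<lambda>n. G (n + m)) (\<lambda>n. D (n + m)) (\<lambda>n. v (n + m))"
  using filt sub adapted square_integrable second_moment cond_exp
  by unfold_locales (auto simp: filtration_def)

text \<open>Where the series diverges, there is an \<open>\<epsilon>\<close> such that every tail has a partial sum of modulus at
  least \<open>\<epsilon>\<close>; the maximal inequality for tails makes this event null.\<close>

lemma AE_summable:
  assumes v: "summable v"
  shows "AE \<omega> in M. summable (\<lambda>n. D n \<omega>)"
proof -
  define B where "B \<epsilon> m = {\<omega>\<in>space M. \<exists>k. \<epsilon> \<le> \<bar>\<Sum>i<k. D (i + m) \<omega>\<bar>}" for \<epsilon> m
  have B [measurable]: "B \<epsilon> m \<in> sets M" for \<epsilon> m unfolding B_def by simp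
  have null: "AE \<omega> in M. \<exists>m. \<omega> \<notin> B \<epsilon> m" if \<epsilon>: "0 < \<epsilon>" for \<epsilon>
  proof -
    have "(\<lambda>m. (\<Sum>i. v (i + m)) / \<epsilon>\<^sup>2) \<longlonglongrightarrow> 0 / \<epsilon>\<^sup>2"
      using \<epsilon> by (intro tendsto_divide suminf_exist_split2[OF v] tendsto_const) auto
    moreover have "prob (\<Inter>m. B \<epsilon> m) \<le> (\<Sum>i. v (i + m)) / \<epsilon>\<^sup>2" for m
    proof -
      have "prob (\<Inter>m. B \<epsilon> m) \<le> prob (B \<epsilon> m)" by (rule finite_measure_mono) auto
      also have "\<dots> \<le> (\<Sum>i. v (i + m)) / \<epsilon>\<^sup>2"
        unfolding B_def
        by (rule square_integrable_differences.prob_some_partial_sum_large[OF shift \<epsilon>])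
          (simp add: v)
      finally show ?thesis .
    qed
    ultimately have "prob (\<Inter>m. B \<epsilon> m) \<le> 0"
      by (intro LIMSEQ_le_const[where X = "\<lambda>m. (\<Sum>i. v (i + m)) / \<epsilon>\<^sup>2"]) auto
    then have "prob (\<Inter>m. B \<epsilon> m) = 0" by (simp add: measure_le_0_iff)
    then have "(\<Inter>m. B \<epsilon> m) \<in> null_sets M" by (auto simp: emeasure_eq_measure intro!: null_setsI)
    then show ?thesis by (rule AE_I') auto
  qed
  \<comment> \<open>Countably many thresholds suffice, so the exceptional null sets can be
    united.\<close>
  have "AE \<omega> in M. \<forall>j. \<exists>m. \<omega> \<notin> B (1 / real (Suc j)) m"
    unfolding AE_all_countable by (intro allI null) simp
  then show ?thesis
    using AE_space
  proof eventually_elim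
    case (elim \<omega>)
    show ?case
      unfolding summable_Cauchy
    proof (intro allI impI)
      fix e :: real assume "0 < e"
      \<comment> \<open>Half of \<open>e\<close>, because a block sum is the difference of two
        partial sums that both start at \<open>m\<close>.\<close>
      then obtain j where j: "1 / real (Suc j) < e / 2" using nat_approx_posE[of "e / 2"] by auto
      obtain m where m: "\<omega> \<notin> B (1 / real (Suc j)) m" using elim(1) by blast
      have small: "\<bar>\<Sum>i<k. D (i + m) \<omega>\<bar> < e / 2" for k
      proof -
        have "\<bar>\<Sum>i<k. D (i + m) \<omega>\<bar> < 1 / real (Suc j)"
          using m elim(2) unfolding B_def by (auto simp: not_le)
        then show ?thesis using j by simp
      qed
      have "norm (\<Sum>i\<in>{a..<b}. D i \<omega>) < e" if "m \<le> a" for a b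
      proof (cases "a \<le> b")
        case True
        have tail: "(\<Sum>i\<in>{m..<n}. D i \<omega>) = (\<Sum>i<n - m. D (i + m) \<omega>)" if "m \<le> n" for n
          using sum.shift_bounds_nat_ivl[of "\<lambda>i. D i \<omega>" 0 m "n - m"] that by (simp add: atLeast0LessThan)
        have "(\<Sum>i\<in>{a..<b}. D i \<omega>) = (\<Sum>i\<in>{m..<b}. D i \<omega>) - (\<Sum>i\<in>{m..<a}. D i \<omega>)"
          using sum.atLeastLessThan_concat[OF that True, of "\<lambda>i. D i \<omega>"] by simp
        also have "\<dots> = (\<Sum>i<b - m. D (i + m) \<omega>) - (\<Sum>i<a - m. D (i + m) \<omega>)"
          using tail[of a] tail[of b] that True by simp
        finally show ?thesis using small[of "a - m"] small[of "b - m"] by simp linarith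
      qed (use \<open>0 < e\<close> in simp)
      then show "\<exists>N. \<forall>m\<ge>N. \<forall>n. norm (sum (\<lambda>n. D n \<omega>) {m..<n}) < e" by blast
    qed
  qed
qed

end

text \<open>Each coordinate is a scalar instance with variance bound
  \<open>(\<eta> (Suc t))\<^sup>2 * C\<close>. Iterations start at 1: index \<open>t\<close> of the
  series belongs to iteration \<open>t + 1\<close>, whose noise is measurable for
  \<open>\<F> (Suc (Suc t))\<close> and centred given \<open>\<F> (Suc t)\<close>.\<close>

lemma AE_summable_martingale_noise:
  fixes \<xi> :: "nat \<Rightarrow> 'w \<Rightarrow> 'a::euclidean_space"
  assumes "prob_space M" and filt: "filtration (space M) \<F>" and sub: "\<And>t. subalgebra M (\<F> t)"
    and mom: "bounded_second_moments M \<xi>" and mart: "martingale_differences M \<F> \<xi>"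
    and \<eta>: "summable (\<lambda>t. (\<eta> (Suc t))\<^sup>2)"
  shows "AE \<omega> in M. summable (\<lambda>t. \<eta> (Suc t) *\<^sub>R \<xi> (Suc (Suc t)) \<omega>)"
proof -
  interpret prob_space M by fact
  obtain C where C1: "\<And>t. integrable M (\<lambda>\<omega>. (norm (\<xi> (Suc (Suc t)) \<omega>))\<^sup>2)"
    and C2: "\<And>t. (LINT \<omega>|M. (norm (\<xi> (Suc (Suc t)) \<omega>))\<^sup>2) \<le> C"
    using mom by (auto simp: bounded_second_moments_def)
  have meas: "\<xi> (Suc (Suc t)) \<in> borel_measurable (\<F> (Suc (Suc t)))"
    and int: "integrable M (\<xi> (Suc (Suc t)))"
    and ce: "e \<in> Basis \<Longrightarrow> AE \<omega> in M. real_cond_exp M (\<F> (Suc t)) (\<lambda>\<omega>. \<xi> (Suc (Suc t)) \<omega> \<bullet> e) \<omega> = 0" for t e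
    using mart by (auto simp: martingale_differences_def)
  have coord: "AE \<omega> in M. summable (\<lambda>t. \<eta> (Suc t) * (\<xi> (Suc (Suc t)) \<omega> \<bullet> e))" if e: "e \<in> Basis" for e
  proof -
    define D where "D t \<omega> = \<eta> (Suc t) * (\<xi> (Suc (Suc t)) \<omega> \<bullet> e)" for t \<omega>
    have le: "(\<xi> (Suc (Suc t)) \<omega> \<bullet> e)\<^sup>2 \<le> (norm (\<xi> (Suc (Suc t)) \<omega>))\<^sup>2" for t \<omega>
      using Basis_le_norm[OF e, of "\<xi> (Suc (Suc t)) \<omega>"] by (simp add: abs_le_square_iff[symmetric])
    have [measurable]: "\<xi> (Suc (Suc t)) \<in> borel_measurable M" for t
      by (rule measurable_from_subalg[OF sub meas])
    have sq: "integrable M (\<lambda>\<omega>. (\<xi> (Suc (Suc t)) \<omega> \<bullet> e)\<^sup>2)" for t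
      by (rule Bochner_Integration.integrable_bound[OF C1[of t]]) (use le in auto)
    interpret D: square_integrable_differences M "\<lambda>t. \<F> (Suc t)" D "\<lambda>t. (\<eta> (Suc t))\<^sup>2 * C"
    proof
      fix t
      show "D t \<in> borel_measurable (\<F> (Suc (Suc t)))"
        unfolding D_def using meas[of t] by simp
      show "integrable M (\<lambda>\<omega>. (D t \<omega>)\<^sup>2)"
        using sq[of t] by (simp add: D_def power_mult_distrib)
      have "(LINT \<omega>|M. (\<xi> (Suc (Suc t)) \<omega> \<bullet> e)\<^sup>2) \<le> C"
        using integral_mono[OF sq C1 le] C2[of t] by (rule order_trans)
      then show "(LINT \<omega>|M. (D t \<omega>)\<^sup>2) \<le> (\<eta> (Suc t))\<^sup>2 * C"
        by (simp add: D_def power_mult_distrib mult_left_mono)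
      interpret finite_measure_subalgebra M "\<F> (Suc t)" by unfold_locales (rule sub)
      interpret sigma_finite_subalgebra M "\<F> (Suc t)"
        by (rule finite_measure_subalgebra_is_sigma_finite) unfold_locales
      have "AE \<omega> in M. real_cond_exp M (\<F> (Suc t)) (D t) \<omega>
          = \<eta> (Suc t) * real_cond_exp M (\<F> (Suc t)) (\<lambda>\<omega>. \<xi> (Suc (Suc t)) \<omega> \<bullet> e) \<omega>"
        unfolding D_def by (rule real_cond_exp_cmult) (use int in simp)
      with ce[OF e, of t] show "AE \<omega> in M. real_cond_exp M (\<F> (Suc t)) (D t) \<omega> = 0"
        by eventually_elim simp
    qed (use filt sub in \<open>auto simp: filtration_def\<close>)
    show ?thesis
      using D.AE_summable \<eta> by (simp add: D_def summable_mult2)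
  qed
  have "AE \<omega> in M. \<forall>e\<in>Basis. summable (\<lambda>t. \<eta> (Suc t) * (\<xi> (Suc (Suc t)) \<omega> \<bullet> e))"
    by (intro AE_finite_allI coord) auto
  then show ?thesis
  proof eventually_elim
    case (elim \<omega>)
    have "summable (\<lambda>t. \<Sum>e\<in>Basis. (\<eta> (Suc t) * (\<xi> (Suc (Suc t)) \<omega> \<bullet> e)) *\<^sub>R e)"
      using elim by (intro summable_sum summable_scaleR_left) auto
    also have "(\<lambda>t. \<Sum>e\<in>Basis. (\<eta> (Suc t) * (\<xi> (Suc (Suc t)) \<omega> \<bullet> e)) *\<^sub>R e)
        = (\<lambda>t. \<eta> (Suc t) *\<^sub>R \<xi> (Suc (Suc t)) \<omega>)"
      by (simp add: scaleR_scaleR[symmetric] scaleR_sum_right[symmetric] euclidean_representation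
          del: scaleR_scaleR)
    finally show ?case .
  qed
qed

section \<open>Interpolated perturbed Euler schemes\<close>

lemma tendsto_0_ennrealI:
  fixes f :: "'a \<Rightarrow> ennreal"
  assumes "\<And>e :: real. 0 < e \<Longrightarrow> \<forall>\<^sub>F x in net. f x \<le> ennreal e"
  shows "(f \<longlongrightarrow> 0) net"
proof (rule order_tendstoI)
  fix a :: ennreal assume "0 < a"
  \<comment> \<open>A number strictly below \<open>a\<close> is finite even if \<open>a\<close> is
    infinite.\<close>
  then obtain b where b: "0 < b" "b < a" using dense by blast
  then obtain r where r: "b = ennreal r" "0 \<le> r" by (cases b) auto
  with b have "0 < r" by (auto simp: less_le)
  from assms[OF this] show "\<forall>\<^sub>F x in net. f x < a"
    by eventually_elim (use b r in auto)
qed auto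

section \<open>Step times and the piecewise affine interpolation\<close>

text \<open>There are two kinds of error: \<open>c\<close> has a convergent series, possibly only
  conditionally, while \<open>d\<close> need not be summable but is small relative to the step. The
  assumption \<open>stall\<close> covers steps of length 0: without it the path would have to jump
  at a single time.\<close>

locale perturbed_euler =
  fixes \<eta> \<delta> :: "nat \<Rightarrow> real" and w c d :: "nat \<Rightarrow> 'a::euclidean_space"
    and F :: "'a \<Rightarrow> 'a" and K U :: "'a set" and L :: real
  assumes compact_K: "compact K" and open_U: "open U" and K_U: "K \<subseteq> U"
    and lipschitz_F: "L-lipschitz_on U F"
    and \<eta>_nonneg: "\<And>t. 1 \<le> t \<Longrightarrow> 0 \<le> \<eta> t"
    and \<eta>_sum: "filterlim (\<lambda>n. \<Sum>t=1..n. \<eta> t) at_top sequentially"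
    and \<eta>_lim: "\<eta> \<longlonglongrightarrow> 0"
    and w_K: "\<And>t. 1 \<le> t \<Longrightarrow> w t \<in> K"
    and step: "\<And>t. 1 \<le> t \<Longrightarrow> w (Suc t) = w t + \<eta> t *\<^sub>R F (w t) + c t + d t"
    and stall: "\<And>t. 1 \<le> t \<Longrightarrow> \<eta> t = 0 \<Longrightarrow> w (Suc t) = w t"
    and summable_c: "summable c"
    and d_le: "\<And>t. 1 \<le> t \<Longrightarrow> norm (d t) \<le> \<eta> t * \<delta> t" and \<delta>_lim: "\<delta> \<longlonglongrightarrow> 0"
begin

abbreviation \<sigma> :: "nat \<Rightarrow> real" where "\<sigma> \<equiv> step_time \<eta>"
abbreviation X :: "real \<Rightarrow> 'a" where "X \<equiv> interpolation \<eta> w"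

definition jump :: "nat \<Rightarrow> real" where "jump t = norm (w (Suc t) - w t)"

lemma step_time_Suc: "1 \<le> t \<Longrightarrow> \<sigma> (Suc t) = \<sigma> t + \<eta> t"
  by (simp add: step_time_def)

lemma step_time_mono:
  assumes "1 \<le> m" and "m \<le> n"
  shows "\<sigma> m \<le> \<sigma> n"
  using assms(2)
proof (induction rule: dec_induct)
  case (step n)
  then show ?case using step_time_Suc[of n] \<eta>_nonneg[of n] assms(1) by simp
qed simp

lemma step_time_unbounded: "\<exists>n\<ge>1. s < \<sigma> n"
proof -
  have "\<forall>\<^sub>F n in sequentially. s < (\<Sum>t=1..n. \<eta> t)"
    using \<eta>_sum by (simp add: filterlim_at_top_dense)
  then obtain n where "s < (\<Sum>t=1..n. \<eta> t)" by (auto simp: eventually_sequentially)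
  then have "s < \<sigma> (Suc n)" by (simp add: step_time_def atLeastLessThanSuc_atLeastAtMost)
  then show ?thesis by (intro exI[of _ "Suc n"]) auto
qed

lemma step_time_bracket:
  assumes "0 \<le> s"
  obtains t where "1 \<le> t" "\<sigma> t \<le> s" "s < \<sigma> (Suc t)"
proof -
  define n where "n = (LEAST n. 1 \<le> n \<and> s < \<sigma> n)"
  have n: "1 \<le> n \<and> s < \<sigma> n"
    unfolding n_def by (rule LeastI_ex) (use step_time_unbounded in blast)
  have "n \<noteq> 1" using n assms by (auto simp: step_time_def)
  then obtain t where t: "n = Suc t" "1 \<le> t" using n by (cases n) auto
  have "\<not> (1 \<le> t \<and> s < \<sigma> t)"
    unfolding t by (rule not_less_Least[of t "\<lambda>n. 1 \<le> n \<and> s < \<sigma> n"]) (use t n_def in simp)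
  then show ?thesis using that[of t] t n by auto
qed

lemma interpolation_half_open:
  assumes t: "1 \<le> t" "\<sigma> t \<le> s" "s < \<sigma> (Suc t)"
  shows "X s = w t + ((s - \<sigma> t) / \<eta> t) *\<^sub>R (w (Suc t) - w t)"
proof -
  have "(GREATEST t. 1 \<le> t \<and> \<sigma> t \<le> s) = t"
  proof (rule Greatest_equality)
    fix t' assume t': "1 \<le> t' \<and> \<sigma> t' \<le> s"
    show "t' \<le> t"
    proof (rule ccontr)
      assume "\<not> t' \<le> t"
      then have "\<sigma> (Suc t) \<le> \<sigma> t'" by (intro step_time_mono) auto
      with t' t show False by simp
    qed
  qed (use t in simp)
  then show ?thesis by (simp add: interpolation_def)
qed

text \<open>Zero steps let several indices share the time \<open>\<sigma> t\<close>, and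
  \<open>GREATEST\<close> selects the last of them; by \<open>stall\<close> the iterates agree along
  the tie.\<close>

lemma interpolation_grid:
  assumes t: "1 \<le> t"
  shows "X (\<sigma> t) = w t"
proof -
  have "0 \<le> \<sigma> t" using step_time_mono[of 1 t] t by (simp add: step_time_def)
  then obtain t' where t': "1 \<le> t'" "\<sigma> t' \<le> \<sigma> t" "\<sigma> t < \<sigma> (Suc t')"
    by (rule step_time_bracket)
  have "t \<le> t'"
    using step_time_mono[of "Suc t'" t] t' by (cases "t \<le> t'") auto
  then have "\<sigma> t' = \<sigma> t" using step_time_mono[OF t] t' by force
  have "w k = w t" if "t \<le> k" "\<sigma> k = \<sigma> t" for k
    using that
  proof (induction rule: dec_induct)
    case (step k)
    have "\<sigma> k = \<sigma> t"
      using step_time_mono[of t k] step_time_mono[of k "Suc k"] step t by auto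
    moreover have "\<eta> k = 0" using step_time_Suc[of k] step t \<open>\<sigma> k = \<sigma> t\<close> by auto
    ultimately show ?case using step stall[of k] t by auto
  qed simp
  then have "w t' = w t" using \<open>t \<le> t'\<close> \<open>\<sigma> t' = \<sigma> t\<close> by blast
  then show ?thesis using interpolation_half_open[OF t'] \<open>\<sigma> t' = \<sigma> t\<close> by simp
qed

text \<open>At the right end the definition already uses a later piece, and the values match by
  \<open>interpolation_grid\<close>. If \<open>\<eta> t = 0\<close>, the quotient is 0 by convention
  and \<open>stall\<close> gives the equality.\<close>

lemma interpolation_closed:
  assumes t: "1 \<le> t" and s: "s \<in> {\<sigma> t..\<sigma> (Suc t)}"
  shows "X s = w t + ((s - \<sigma> t) / \<eta> t) *\<^sub>R (w (Suc t) - w t)"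
proof (cases "s < \<sigma> (Suc t)")
  case True
  then show ?thesis using interpolation_half_open t s by simp
next
  case False
  then have "s = \<sigma> (Suc t)" using s by simp
  then show ?thesis
    using interpolation_grid[of "Suc t"] step_time_Suc[OF t] stall[OF t] by (cases "\<eta> t = 0") auto
qed

lemma interpolation_near_grid:
  assumes t: "1 \<le> t" and s: "s \<in> {\<sigma> t..\<sigma> (Suc t)}"
  shows "norm (X s - w t) \<le> jump t"
proof -
  have "0 \<le> (s - \<sigma> t) / \<eta> t" "(s - \<sigma> t) / \<eta> t \<le> 1"
    using s \<eta>_nonneg[OF t] step_time_Suc[OF t] by (auto simp: divide_le_eq_1)
  then show ?thesis
    unfolding interpolation_closed[OF t s] jump_def
    by (simp add: mult_left_le_one_le del: times_divide_eq_left)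
qed

lemma continuous_on_interpolation: "continuous_on {0..} X"
proof -
  have fin: "continuous_on {0..\<sigma> n} X" if "1 \<le> n" for n
    using that
  proof (induction n rule: dec_induct)
    case base
    show ?case by (simp add: step_time_def)
  next
    case (step n)
    have "continuous_on {\<sigma> n..\<sigma> (Suc n)} (\<lambda>s. w n + ((s - \<sigma> n) / \<eta> n) *\<^sub>R (w (Suc n) - w n))"
      unfolding divide_inverse by (intro continuous_intros)
    then have "continuous_on {\<sigma> n..\<sigma> (Suc n)} X"
      using interpolation_closed[OF step(1)] by (subst continuous_on_cong[OF refl]) auto
    with step.IH have "continuous_on ({0..\<sigma> n} \<union> {\<sigma> n..\<sigma> (Suc n)}) X"
      by (intro continuous_on_closed_Un) auto
    also have "{0..\<sigma> n} \<union> {\<sigma> n..\<sigma> (Suc n)} = {0..\<sigma> (Suc n)}"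
      using step_time_mono[of 1 n] step_time_mono[of n "Suc n"] step(1)
      by (intro ivl_disj_un_two_touch) (auto simp: step_time_def)
    finally show ?case .
  qed
  show ?thesis
    unfolding continuous_on_eq_continuous_within
  proof
    fix s :: real assume s: "s \<in> {0..}"
    obtain n where n: "1 \<le> n" "s < \<sigma> n" using step_time_unbounded by blast
    have "at s within {0..} = at s within {0..\<sigma> n}"
      by (rule at_within_nhd[of s "{..<\<sigma> n}"]) (use n in auto)
    then show "continuous (at s within {0..}) X"
      using fin[OF n(1)] s n by (auto simp: continuous_on_eq_continuous_within continuous_within)
  qed
qed

lemma field_bounded: obtains B where "\<And>x. x \<in> K \<Longrightarrow> norm (F x) \<le> B"
proof -
  have "continuous_on K F"
    using continuous_on_subset[OF lipschitz_on_continuous_on[OF lipschitz_F] K_U] .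
  then have "bounded (F ` K)" by (intro compact_imp_bounded compact_continuous_image compact_K)
  then show ?thesis using that by (auto simp: bounded_iff)
qed

lemma jump_lim: "jump \<longlonglongrightarrow> 0"
proof -
  obtain B where B: "\<And>x. x \<in> K \<Longrightarrow> norm (F x) \<le> B" by (rule field_bounded) blast
  have le: "norm (jump t) \<le> \<eta> t * B + norm (c t) + \<eta> t * \<delta> t" if t: "1 \<le> t" for t
  proof -
    have "jump t = norm (\<eta> t *\<^sub>R F (w t) + c t + d t)"
      by (simp add: jump_def step[OF t] algebra_simps)
    also have "\<dots> \<le> norm (\<eta> t *\<^sub>R F (w t)) + norm (c t) + norm (d t)"
      by (intro order_trans[OF norm_triangle_ineq] add_right_mono norm_triangle_ineq)
    also have "\<dots> \<le> \<eta> t * B + norm (c t) + \<eta> t * \<delta> t"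
      using d_le[OF t] \<eta>_nonneg[OF t] B[OF w_K[OF t]] by (auto intro!: add_mono mult_left_mono)
    finally show ?thesis by (simp add: jump_def)
  qed
  have "(\<lambda>t. \<eta> t * B + norm (c t) + \<eta> t * \<delta> t) \<longlonglongrightarrow> 0 * B + 0 + 0 * 0"
    by (intro tendsto_intros \<eta>_lim \<delta>_lim tendsto_norm_zero summable_LIMSEQ_zero summable_c)
  then have "(\<lambda>t. \<eta> t * B + norm (c t) + \<eta> t * \<delta> t) \<longlonglongrightarrow> 0" by simp
  then show ?thesis
    by (rule Lim_null_comparison[rotated]) (use le in \<open>auto simp: eventually_sequentially\<close>)
qed

end

section \<open>Defect in the integral equation and shadowing by the flow\<close>

text \<open>Early affine pieces may even leave \<open>U\<close>, where nothing is known about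
  \<open>F\<close>; integrals along the path therefore use the extension \<open>g\<close>.\<close>

locale perturbed_euler_extension = perturbed_euler +
  fixes g :: "'a \<Rightarrow> 'a" and L' :: real
  assumes lipschitz_g: "L'-lipschitz_on UNIV g" and g_F: "\<And>x. x \<in> U \<Longrightarrow> g x = F x"
begin

text \<open>The increment of \<open>Z\<close> over a window is the defect of \<open>X\<close> in the
  integral equation there. Anchoring the integral at 0 makes defects of adjacent windows add
  up.\<close>

definition Z :: "real \<Rightarrow> 'a" where "Z s = X s - integral {0..s} (\<lambda>u. g (X u))"

lemma continuous_on_field: "0 \<le> a \<Longrightarrow> continuous_on {a..b} (\<lambda>u. g (X u))"
  by (rule continuous_on_compose2[OF lipschitz_on_continuous_on[OF lipschitz_g]
        continuous_on_subset[OF continuous_on_interpolation]]) auto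

lemma Z_diff:
  assumes "0 \<le> a" and "a \<le> b"
  shows "Z b - Z a = X b - X a - integral {a..b} (\<lambda>u. g (X u))"
proof -
  have "integral {0..a} (\<lambda>u. g (X u)) + integral {a..b} (\<lambda>u. g (X u)) = integral {0..b} (\<lambda>u. g (X u))"
    using assms by (intro Henstock_Kurzweil_Integration.integral_combine integrable_continuous_real
        continuous_on_field) auto
  then show ?thesis by (simp add: Z_def algebra_simps)
qed

lemma integral_field_near_grid:
  assumes t: "1 \<le> t" and s: "s \<in> {\<sigma> t..\<sigma> (Suc t)}"
  shows "norm (integral {\<sigma> t..s} (\<lambda>u. g (X u)) - (s - \<sigma> t) *\<^sub>R F (w t)) \<le> (s - \<sigma> t) * (L' * jump t)"
proof -
  have \<sigma>0: "0 \<le> \<sigma> t" using step_time_mono[of 1 t] t by (simp add: step_time_def)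
  have i: "(\<lambda>u. g (X u)) integrable_on {\<sigma> t..s}"
    by (intro integrable_continuous_real continuous_on_field \<sigma>0)
  have "integral {\<sigma> t..s} (\<lambda>u. g (X u)) - (s - \<sigma> t) *\<^sub>R F (w t)
      = integral {\<sigma> t..s} (\<lambda>u. g (X u) - F (w t))"
    using i s by (subst integral_diff) auto
  also have "norm \<dots> \<le> integral {\<sigma> t..s} (\<lambda>u. L' * jump t)"
  proof (rule integral_norm_bound_integral)
    fix u assume u: "u \<in> {\<sigma> t..s}"
    have "F (w t) = g (w t)" using g_F w_K[OF t] K_U by auto
    then have "norm (g (X u) - F (w t)) \<le> L' * norm (X u - w t)"
      using lipschitz_onD[OF lipschitz_g, of "X u" "w t"] by (simp add: dist_norm)
    also have "\<dots> \<le> L' * jump t"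
      using interpolation_near_grid[OF t, of u] u s lipschitz_on_nonneg[OF lipschitz_g]
      by (intro mult_left_mono) auto
    finally show "norm (g (X u) - F (w t)) \<le> L' * jump t" .
  qed (intro integrable_diff i integrable_const_ivl)+
  finally show ?thesis using s by (simp add: mult_ac)
qed

text \<open>After removal of \<open>c t\<close>, only \<open>d t\<close> and the error of freezing
  the field at \<open>w t\<close> remain. Both are proportional to \<open>\<eta> t\<close> and can
  be summed in norm, unlike \<open>c t\<close>.\<close>

lemma Z_step:
  assumes t: "1 \<le> t"
  shows "norm (Z (\<sigma> (Suc t)) - Z (\<sigma> t) - c t) \<le> \<eta> t * (\<delta> t + L' * jump t)"
proof -
  have \<sigma>0: "0 \<le> \<sigma> t" using step_time_mono[of 1 t] t by (simp add: step_time_def)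
  let ?I = "integral {\<sigma> t..\<sigma> (Suc t)} (\<lambda>u. g (X u))"
  have \<sigma>: "\<sigma> t \<le> \<sigma> (Suc t)" "\<sigma> (Suc t) - \<sigma> t = \<eta> t"
    using step_time_Suc[OF t] \<eta>_nonneg[OF t] by auto
  have "Z (\<sigma> (Suc t)) - Z (\<sigma> t) = w (Suc t) - w t - ?I"
    using Z_diff[OF \<sigma>0 \<sigma>(1)] interpolation_grid[OF t] interpolation_grid[of "Suc t"] by simp
  then have "Z (\<sigma> (Suc t)) - Z (\<sigma> t) - c t = d t - (?I - \<eta> t *\<^sub>R F (w t))"
    using step[OF t] by (simp add: algebra_simps)
  also have "norm \<dots> \<le> norm (d t) + norm (?I - \<eta> t *\<^sub>R F (w t))" by (rule norm_triangle_ineq4)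
  also have "\<dots> \<le> \<eta> t * \<delta> t + \<eta> t * (L' * jump t)"
    using d_le[OF t] integral_field_near_grid[OF t, of "\<sigma> (Suc t)"] \<sigma> by (intro add_mono) auto
  finally show ?thesis by (simp add: algebra_simps)
qed

text \<open>The number of steps in a window is not bounded, but their total length is; hence the
  bound is \<kappa> times elapsed time.\<close>

lemma Z_grid:
  assumes m: "1 \<le> m" and n: "m \<le> n" and \<kappa>: "\<And>t. m \<le> t \<Longrightarrow> \<delta> t + L' * jump t \<le> \<kappa>"
  shows "norm (Z (\<sigma> n) - Z (\<sigma> m) - (\<Sum>t=m..<n. c t)) \<le> (\<sigma> n - \<sigma> m) * \<kappa>"
  using n
proof (induction n rule: dec_induct)
  case (step n)
  have n: "1 \<le> n" using m step by simp
  have "Z (\<sigma> (Suc n)) - Z (\<sigma> m) - (\<Sum>t=m..<Suc n. c t)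
      = (Z (\<sigma> n) - Z (\<sigma> m) - (\<Sum>t=m..<n. c t)) + (Z (\<sigma> (Suc n)) - Z (\<sigma> n) - c n)"
    using step by simp
  also have "norm \<dots> \<le> (\<sigma> n - \<sigma> m) * \<kappa> + \<eta> n * (\<delta> n + L' * jump n)"
    by (rule norm_triangle_mono[OF step.IH Z_step[OF n]])
  also have "\<dots> \<le> (\<sigma> n - \<sigma> m) * \<kappa> + \<eta> n * \<kappa>"
    using \<kappa>[OF step(1)] \<eta>_nonneg[OF n] by (intro add_left_mono mult_left_mono) auto
  finally show ?case using step_time_Suc[OF n] by (simp add: algebra_simps)
qed simp

text \<open>Windows need not begin or end at grid times. A crude bound is enough, as only the two
  partial steps at the ends are affected.\<close>

lemma Z_near_grid:
  assumes B: "\<And>x. x \<in> K \<Longrightarrow> norm (F x) \<le> B" and t: "1 \<le> t" and s: "s \<in> {\<sigma> t..\<sigma> (Suc t)}"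
  shows "norm (Z s - Z (\<sigma> t)) \<le> jump t + \<eta> t * (B + L' * jump t)"
proof -
  have \<sigma>0: "0 \<le> \<sigma> t" using step_time_mono[of 1 t] t by (simp add: step_time_def)
  let ?I = "integral {\<sigma> t..s} (\<lambda>u. g (X u))"
  have "norm ?I \<le> norm ((s - \<sigma> t) *\<^sub>R F (w t)) + norm (?I - (s - \<sigma> t) *\<^sub>R F (w t))"
    by (metis norm_triangle_sub)
  also have "\<dots> \<le> (s - \<sigma> t) * B + (s - \<sigma> t) * (L' * jump t)"
    using integral_field_near_grid[OF t s] s B[OF w_K[OF t]]
    by (intro add_mono) (auto intro!: mult_left_mono)
  also have "\<dots> = (s - \<sigma> t) * (B + L' * jump t)" by (simp add: algebra_simps)
  also have "\<dots> \<le> \<eta> t * (B + L' * jump t)"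
  proof (rule mult_right_mono)
    have "0 \<le> B" using B[OF w_K[OF t]] norm_ge_zero[of "F (w t)"] by linarith
    then show "0 \<le> B + L' * jump t"
      using lipschitz_on_nonneg[OF lipschitz_g] by (simp add: jump_def)
  qed (use s step_time_Suc[OF t] in simp)
  finally have "norm ?I \<le> \<eta> t * (B + L' * jump t)" .
  moreover have "Z s - Z (\<sigma> t) = (X s - w t) - ?I"
    using Z_diff[OF \<sigma>0, of s] s interpolation_grid[OF t] by simp
  ultimately show ?thesis
    using interpolation_near_grid[OF t s] norm_triangle_ineq4[of "X s - w t" ?I] by simp
qed

lemma eventually_Z_small:
  assumes H: "0 < H" and e: "0 < e"
  shows "\<forall>\<^sub>F s in at_top. \<forall>h\<in>{0..H}. norm (Z (s + h) - Z s) \<le> e"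
proof -
  obtain B where B: "\<And>x. x \<in> K \<Longrightarrow> norm (F x) \<le> B" by (rule field_bounded) blast
  define \<rho> where "\<rho> t = jump t + \<eta> t * (B + L' * jump t)" for t
  \<comment> \<open>A quarter of \<open>e\<close> goes to each of the two partial end steps, to the
    sum of \<open>c\<close>, and to the errors proportional to the step. The grid window starts at
    \<open>\<sigma> m\<close>, less than one step (hence less than 1) before \<open>s\<close>, so
    its length is at most \<open>H + 1\<close>.\<close>
  define \<kappa> where "\<kappa> = e / (4 * (H + 1))"
  have "(\<lambda>t. jump t + \<eta> t * (B + L' * jump t)) \<longlonglongrightarrow> 0 + 0 * (B + L' * 0)"
    by (intro tendsto_intros jump_lim \<eta>_lim)
  then have "\<forall>\<^sub>F t in sequentially. \<rho> t < e / 4"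
    unfolding \<rho>_def by (rule order_tendstoD) (use e in simp)
  moreover have "(\<lambda>t. \<delta> t + L' * jump t) \<longlonglongrightarrow> 0 + L' * 0"
    by (intro tendsto_intros jump_lim \<delta>_lim)
  then have "\<forall>\<^sub>F t in sequentially. \<delta> t + L' * jump t < \<kappa>"
    by (rule order_tendstoD) (use e H in \<open>simp add: \<kappa>_def\<close>)
  moreover have "\<forall>\<^sub>F t in sequentially. \<eta> t < 1"
    by (rule order_tendstoD[OF \<eta>_lim]) simp
  moreover have "\<forall>\<^sub>F t in sequentially. \<forall>n. norm (sum c {t..<n}) < e / 4"
    using summable_c e unfolding summable_Cauchy eventually_sequentially
    by (metis divide_pos_pos zero_less_numeral)
  ultimately have "\<forall>\<^sub>F t in sequentially. \<rho> t < e / 4 \<and> \<delta> t + L' * jump t < \<kappa> \<and> \<eta> t < 1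
      \<and> (\<forall>n. norm (sum c {t..<n}) < e / 4)"
    by eventually_elim simp
  then obtain N0 where N0: "\<And>t. N0 \<le> t \<Longrightarrow> \<rho> t < e / 4 \<and> \<delta> t + L' * jump t < \<kappa> \<and> \<eta> t < 1
      \<and> (\<forall>n. norm (sum c {t..<n}) < e / 4)"
    unfolding eventually_sequentially by blast
  define N where "N = max 1 N0"
  have N: "1 \<le> N" "N0 \<le> N" by (auto simp: N_def)
  have "norm (Z (s + h) - Z s) \<le> e" if s: "\<sigma> N \<le> s" and h: "h \<in> {0..H}" for s h
  proof -
    have s0: "0 \<le> s" using step_time_mono[of 1 N] N s by (simp add: step_time_def)
    obtain m where m: "1 \<le> m" "\<sigma> m \<le> s" "s < \<sigma> (Suc m)" using step_time_bracket[OF s0] .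
    obtain n where n: "1 \<le> n" "\<sigma> n \<le> s + h" "s + h < \<sigma> (Suc n)"
      using step_time_bracket[of "s + h"] s0 h by auto
    have Nm: "N \<le> m" using step_time_mono[of "Suc m" N] m s by (cases "N \<le> m") auto
    have mn: "m \<le> n" using step_time_mono[of "Suc n" m] m n h by (cases "m \<le> n") auto
    have large: "N0 \<le> t" if "m \<le> t" for t using that Nm N by simp
    have "norm (Z (\<sigma> n) - Z (\<sigma> m) - (\<Sum>t=m..<n. c t)) \<le> (\<sigma> n - \<sigma> m) * \<kappa>"
      using N0 large by (intro Z_grid m mn) (auto intro: less_imp_le)
    also have "\<dots> \<le> (H + 1) * \<kappa>"
    proof (rule mult_right_mono)
      have "\<eta> m < 1" using N0 large by blast
      then show "\<sigma> n - \<sigma> m \<le> H + 1" using step_time_Suc[OF m(1)] m n h by auto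
    qed (use e H in \<open>simp add: \<kappa>_def\<close>)
    also have "\<dots> = e / 4" using H by (simp add: \<kappa>_def field_simps)
    finally have 1: "norm (Z (\<sigma> n) - Z (\<sigma> m) - (\<Sum>t=m..<n. c t)) \<le> e / 4" .
    have 2: "norm (\<Sum>t=m..<n. c t) \<le> e / 4" using N0 large by (auto intro: less_imp_le)
    have "norm (Z s - Z (\<sigma> m)) \<le> \<rho> m"
      unfolding \<rho>_def using m by (intro Z_near_grid B) auto
    then have 3: "norm (Z s - Z (\<sigma> m)) \<le> e / 4" using N0[OF large[of m]] by simp
    have "norm (Z (s + h) - Z (\<sigma> n)) \<le> \<rho> n"
      unfolding \<rho>_def using n by (intro Z_near_grid B) auto
    then have 4: "norm (Z (s + h) - Z (\<sigma> n)) \<le> e / 4" using N0[OF large[OF mn]] by simp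
    have "Z (s + h) - Z s = ((Z (s + h) - Z (\<sigma> n)) - (Z s - Z (\<sigma> m)))
        + ((Z (\<sigma> n) - Z (\<sigma> m) - (\<Sum>t=m..<n. c t)) + (\<Sum>t=m..<n. c t))"
      by simp
    also have "norm \<dots> \<le> (e / 4 + e / 4) + (e / 4 + e / 4)"
      by (intro norm_triangle_mono norm_triangle_le_diff add_mono 1 2 3 4)
    finally show ?thesis by simp
  qed
  then show ?thesis unfolding eventually_at_top_linorder by blast
qed

lemma eventually_interpolation_near_K:
  assumes e: "0 < e"
  shows "\<forall>\<^sub>F s in at_top. infdist (X s) K \<le> e"
proof -
  obtain N0 where N0: "\<And>t. N0 \<le> t \<Longrightarrow> jump t < e"
    using order_tendstoD(2)[OF jump_lim e] by (auto simp: eventually_sequentially)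
  define N where "N = max 1 N0"
  have N: "1 \<le> N" "N0 \<le> N" by (auto simp: N_def)
  have "infdist (X s) K \<le> e" if s: "\<sigma> N \<le> s" for s
  proof -
    have s0: "0 \<le> s" using step_time_mono[of 1 N] N s by (simp add: step_time_def)
    obtain m where m: "1 \<le> m" "\<sigma> m \<le> s" "s < \<sigma> (Suc m)" using step_time_bracket[OF s0] .
    have Nm: "N \<le> m" using step_time_mono[of "Suc m" N] m s by (cases "N \<le> m") auto
    have "infdist (X s) K \<le> dist (X s) (w m)" by (rule infdist_le[OF w_K[OF m(1)]])
    also have "\<dots> \<le> jump m" using interpolation_near_grid[OF m(1), of s] m by (simp add: dist_norm)
    also have "\<dots> \<le> e" using N0[of m] Nm N by simp
    finally show ?thesis .
  qed
  then show ?thesis unfolding eventually_at_top_linorder by blast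
qed

lemma eventually_shadowed:
  assumes H: "0 < H" and e: "0 < e"
  shows "\<forall>\<^sub>F s in at_top. \<exists>y. ode_solution U F (X s) {0..H} y \<and>
    (\<forall>h\<in>{0..H}. norm (X (s + h) - flow U F h (X s)) \<le> e)"
proof -
  have "K \<noteq> {}" using w_K[of 1] by auto
  then obtain r where r: "0 < r" "{x. infdist x K \<le> r} \<subseteq> U"
    using compact_in_open_separated[OF _ compact_K open_U K_U] by metis
  \<comment> \<open>One half of the margin \<open>r\<close> is spent on the distance from the path
    to \<open>K\<close>, the other on the distance from the solution to the path. The defect
    \<Delta> is scaled so that the Gronwall factor turns it into \<open>e'\<close>.\<close>
  define e' where "e' = min e (r / 2)"
  define \<Delta> where "\<Delta> = e' * exp (- (L' * H))"
  have e': "0 < e'" "e' \<le> e" "e' \<le> r / 2" using e r by (auto simp: e'_def)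
  have \<Delta>: "0 < \<Delta>" "\<Delta> * exp (L' * H) = e'" using e' by (auto simp: \<Delta>_def exp_minus)
  obtain S where S: "\<And>s. S \<le> s \<Longrightarrow> infdist (X s) K \<le> r / 2"
    using eventually_interpolation_near_K[of "r / 2"] r by (auto simp: eventually_at_top_linorder)
  show ?thesis
    using eventually_Z_small[OF H \<Delta>(1)] eventually_ge_at_top[of S] eventually_ge_at_top[of 0]
  proof eventually_elim
    case (elim s)
    have cont: "continuous_on {0..H} (\<lambda>h. X (s + h))"
      by (rule continuous_on_compose2[OF continuous_on_interpolation])
        (use elim in \<open>auto intro!: continuous_intros\<close>)
    have defect: "norm (X (s + h) - X (s + 0) - integral {0..h} (\<lambda>u. g (X (s + u)))) \<le> \<Delta>"
      if h: "h \<in> {0..H}" for h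
    proof -
      have "integral {0..h} (\<lambda>u. g (X (s + u))) = integral {s..s + h} (\<lambda>u. g (X u))"
        using integral_shift_Icc_real[of 0 h "\<lambda>u. g (X u)" s] by (simp add: o_def add.commute)
      then show ?thesis
        using Z_diff[of s "s + h"] elim h by (metis add_0_right atLeastAtMost_iff le_add_same_cancel1)
    qed
    have ball: "cball (X (s + h)) (\<Delta> * exp (L' * H)) \<subseteq> U" if h: "h \<in> {0..H}" for h
    proof
      fix x assume "x \<in> cball (X (s + h)) (\<Delta> * exp (L' * H))"
      then have "dist x (X (s + h)) \<le> r / 2" using \<Delta> e' by (simp add: dist_commute)
      moreover have "infdist x K \<le> infdist (X (s + h)) K + dist x (X (s + h))"
        by (rule infdist_triangle)
      ultimately have "infdist x K \<le> r" using S[of "s + h"] elim h by auto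
      then show "x \<in> U" using r by auto
    qed
    obtain y where y: "ode_solution U F (X (s + 0)) {0..H} y"
      and close: "\<And>h. h \<in> {0..H} \<Longrightarrow> norm (X (s + h) - y h) \<le> \<Delta> * exp (L' * H)"
      using ode_solution_near_approximate_solution[OF lipschitz_g g_F _ cont defect ball] H by auto
    have "norm (X (s + h) - flow U F h (X s)) \<le> e" if h: "h \<in> {0..H}" for h
      using flow_eq[OF lipschitz_F, of "X s" H y h] y h close[OF h] \<Delta> e' by simp
    then show ?case using y by auto
  qed
qed

lemma interpolation_asymptotic_pseudotrajectory: "asymptotic_pseudotrajectory U F X"
  unfolding asymptotic_pseudotrajectory_def
proof (intro conjI allI impI continuous_on_interpolation tendsto_0_ennrealI)
  fix H :: real assume H: "0 < H"
  show "\<forall>\<^sub>F s in at_top. \<exists>y. ode_solution U F (X s) {0..H} y"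
    using eventually_shadowed[OF H zero_less_one] by eventually_elim blast
  fix e :: real assume "0 < e"
  from eventually_shadowed[OF H this]
  show "\<forall>\<^sub>F s in at_top. (SUP h\<in>{0..H}. ennreal (norm (X (s + h) - flow U F h (X s)))) \<le> ennreal e"
    by eventually_elim (auto intro!: SUP_least ennreal_leI)
qed

end

lemma (in perturbed_euler) asymptotic_pseudotrajectory_interpolation:
  "asymptotic_pseudotrajectory U F X"
proof -
  obtain g L' where g: "L'-lipschitz_on UNIV g" "\<And>x. x \<in> U \<Longrightarrow> g x = F x"
    using euclidean_lipschitz_extension[OF lipschitz_F] by metis
  interpret perturbed_euler_extension \<eta> \<delta> w c d F K U L g L'
    by unfold_locales (use g in auto)
  show ?thesis by (rule interpolation_asymptotic_pseudotrajectory)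
qed

section \<open>Alternating updates and stationarity\<close>

lemma grad_eq:
  assumes "GDERIV f x :> D"
  shows "grad f x = D"
  unfolding grad_def
proof (rule the_equality)
  show "GDERIV f x :> D" by fact
  fix D' assume "GDERIV f x :> D'"
  then have "(\<lambda>h. h \<bullet> D') = (\<lambda>h. h \<bullet> D)"
    using assms unfolding gderiv_def by (rule has_derivative_unique)
  then show "D' = D" by (metis inner_commute vector_eq_ldot)
qed

lemma GDERIV_fst:
  assumes "GDERIV f (a, b) :> D"
  shows "GDERIV (\<lambda>a. f (a, b)) a :> fst D"
proof -
  have "((\<lambda>a. (a, b)) has_derivative (\<lambda>h. (h, 0))) (at a)"
    by (intro has_derivative_Pair has_derivative_ident has_derivative_const)
  from has_derivative_compose[OF this assms[unfolded gderiv_def]] show ?thesis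
    by (simp add: gderiv_def inner_prod_def)
qed

lemma GDERIV_snd:
  assumes "GDERIV f (a, b) :> D"
  shows "GDERIV (\<lambda>b. f (a, b)) b :> snd D"
proof -
  have "((\<lambda>b. (a, b)) has_derivative (\<lambda>h. (0, h))) (at b)"
    by (intro has_derivative_Pair has_derivative_ident has_derivative_const)
  from has_derivative_compose[OF this assms[unfolded gderiv_def]] show ?thesis
    by (simp add: gderiv_def inner_prod_def)
qed

text \<open>Smoothness is assumed for the joint gradients, whereas the field consists of partial
  ones. These are components of the joint gradients, and projections do not increase
  distances.\<close>

lemma lipschitz_on_game_field:
  fixes G :: "('task, 'u, 'out, 'p::real_inner, 'q::real_inner) game"
  assumes f: "C1_lipschitz_gradient_on U (\<lambda>(\<phi>, \<theta>). generator_objective G \<phi> \<theta>)"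
    and v: "C1_lipschitz_gradient_on U (\<lambda>(\<phi>, \<theta>). verifier_objective G \<theta> \<phi>)"
  obtains L where "L-lipschitz_on U (game_field G)"
proof -
  define gf where "gf = grad (\<lambda>(\<phi>, \<theta>). generator_objective G \<phi> \<theta>)"
  define gv where "gv = grad (\<lambda>(\<phi>, \<theta>). verifier_objective G \<theta> \<phi>)"
  obtain Lf Lv where L: "Lf-lipschitz_on U gf" "Lv-lipschitz_on U gv"
    using f v by (auto simp: C1_lipschitz_gradient_on_def gf_def gv_def)
  have "Lf-lipschitz_on U (\<lambda>x. fst (gf x))"
    by (rule lipschitz_onI[OF order_trans[OF dist_fst_le lipschitz_onD[OF L(1)]] lipschitz_on_nonneg[OF L(1)]])
  moreover have "Lv-lipschitz_on U (\<lambda>x. snd (gv x))"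
    by (rule lipschitz_onI[OF order_trans[OF dist_snd_le lipschitz_onD[OF L(2)]] lipschitz_on_nonneg[OF L(2)]])
  ultimately have "(sqrt (Lf\<^sup>2 + Lv\<^sup>2))-lipschitz_on U (\<lambda>x. (fst (gf x), snd (gv x)))"
    by (rule lipschitz_on_Pair)
  moreover have "game_field G x = (fst (gf x), snd (gv x))" if x: "x \<in> U" for x
  proof -
    obtain \<phi> \<theta> where [simp]: "x = (\<phi>, \<theta>)" by (cases x)
    obtain D where D: "GDERIV (\<lambda>(\<phi>, \<theta>). generator_objective G \<phi> \<theta>) (\<phi>, \<theta>) :> D"
      using f x by (auto simp: C1_lipschitz_gradient_on_def)
    obtain E where E: "GDERIV (\<lambda>(\<phi>, \<theta>). verifier_objective G \<theta> \<phi>) (\<phi>, \<theta>) :> E"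
      using v x by (auto simp: C1_lipschitz_gradient_on_def)
    show ?thesis
      using grad_eq[OF GDERIV_fst[OF D]] grad_eq[OF GDERIV_snd[OF E]] grad_eq[OF D] grad_eq[OF E]
      by (simp add: game_field_def grad_generator_def grad_verifier_def gf_def gv_def)
  qed
  ultimately have "(sqrt (Lf\<^sup>2 + Lv\<^sup>2))-lipschitz_on U (game_field G)"
    by (subst lipschitz_on_cong[OF refl]) auto
  then show ?thesis by (rule that)
qed

text \<open>If \<open>F p\<close> were nonzero, the solution that starts at \<open>p\<close> would drift in the direction \<open>F p\<close>
  with speed bounded below for as long as it stays near \<open>p\<close>.\<close>

lemma asymptotically_stable_imp_zero:
  fixes F :: "'a::real_inner \<Rightarrow> 'a"
  assumes F: "continuous_on U F" and stable: "asymptotically_stable U F p"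
  shows "F p = 0"
proof (rule ccontr)
  assume "F p \<noteq> 0"
  define v where "v = F p"
  have v: "0 < norm v" using \<open>F p \<noteq> 0\<close> by (simp add: v_def)
  have stab: "\<exists>y. ode_solution U F p {0..} y \<and> (\<forall>h\<ge>0. y h \<in> ball p \<epsilon>)" if "0 < \<epsilon>" for \<epsilon>
  proof -
    have "\<exists>r>0. \<forall>x\<in>ball p r. \<exists>y. ode_solution U F x {0..} y \<and> (\<forall>h\<ge>0. y h \<in> ball p \<epsilon>)"
      using stable[unfolded asymptotically_stable_def, THEN conjunct1, rule_format, OF that] .
    then obtain r where "0 < r"
      and r: "\<forall>x\<in>ball p r. \<exists>y. ode_solution U F x {0..} y \<and> (\<forall>h\<ge>0. y h \<in> ball p \<epsilon>)"
      by (elim exE conjE)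
    show ?thesis by (rule r[THEN bspec]) (simp add: \<open>0 < r\<close>)
  qed
  have p: "p \<in> U"
  proof -
    obtain y where "ode_solution U F p {0..} y" using stab[of 1] by auto
    then have "y 0 = p" "y 0 \<in> U" by (auto simp: ode_solution_def)
    then show ?thesis by simp
  qed
  obtain e where e: "0 < e" "\<And>x. x \<in> U \<Longrightarrow> dist x p < e \<Longrightarrow> dist (F x) v < norm v / 2"
    using F[unfolded continuous_on_iff, rule_format, OF p, of "norm v / 2"] v unfolding v_def by auto
  obtain y where y: "ode_solution U F p {0..} y" and ball: "\<And>h. 0 \<le> h \<Longrightarrow> y h \<in> ball p e"
    using stab[OF e(1)] by blast
  have speed: "(norm v)\<^sup>2 / 2 \<le> F (y h) \<bullet> v" if "0 \<le> h" for h
  proof -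
    have "y h \<in> U" "dist (y h) p < e"
      using y ball[OF that] that by (auto simp: ode_solution_def dist_commute)
    then have "norm (v - F (y h)) \<le> norm v / 2"
      using e(2)[of "y h"] by (simp add: dist_norm norm_minus_commute)
    then have "norm (v - F (y h)) * norm v \<le> norm v / 2 * norm v"
      by (rule mult_right_mono) simp
    then have "(v - F (y h)) \<bullet> v \<le> (norm v)\<^sup>2 / 2"
      using norm_cauchy_schwarz[of "v - F (y h)" v] by (simp add: power2_eq_square)
    then show ?thesis by (simp add: inner_diff_left power2_norm_eq_inner)
  qed
  \<comment> \<open>At speed at least \<open>norm v / 2\<close> in direction \<open>v\<close>, the
    distance \<open>e\<close> is covered by time \<open>2 * e / norm v\<close>; the extra 1 makes
    the contradiction strict.\<close>
  define T where "T = 2 * e / norm v + 1"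
  have T: "0 < T" using e v by (simp add: T_def add_pos_pos)
  have "\<exists>s\<in>{0<..<T}. y T \<bullet> v - y 0 \<bullet> v = (T - 0) * (F (y s) \<bullet> v)"
  proof (rule mvt_simple[OF T])
    fix s assume s: "0 \<le> s" "s \<le> T"
    have "(y has_vector_derivative F (y s)) (at s within {0..})"
      using y s by (simp add: ode_solution_def)
    then have "(y has_vector_derivative F (y s)) (at s within {0..T})"
      by (rule has_vector_derivative_within_subset) auto
    then show "((\<lambda>s. y s \<bullet> v) has_derivative (\<lambda>h. h * (F (y s) \<bullet> v))) (at s within {0..T})"
      unfolding has_vector_derivative_def by (rule has_derivative_eq_rhs[OF has_derivative_inner_left]) auto
  qed
  then obtain s where "0 < s" and s: "y T \<bullet> v - y 0 \<bullet> v = T * (F (y s) \<bullet> v)" by auto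
  have "T * ((norm v)\<^sup>2 / 2) \<le> T * (F (y s) \<bullet> v)"
    using speed[of s] \<open>0 < s\<close> T by (intro mult_left_mono) auto
  also have "\<dots> = (y T - p) \<bullet> v"
    using s y by (simp add: ode_solution_def inner_diff_left)
  also have "\<dots> \<le> norm (y T - p) * norm v" by (rule norm_cauchy_schwarz)
  also have "\<dots> \<le> e * norm v"
    using ball[of T] T by (intro mult_right_mono) (auto simp: dist_norm norm_minus_commute)
  also have "\<dots> < T * ((norm v)\<^sup>2 / 2)"
    using v by (simp add: T_def field_simps power2_eq_square)
  finally show False by simp
qed

text \<open>The second player reacts to the updated first player. Relative to a simultaneous update this
  costs \<open>\<eta> t\<close> times a multiple of the vanishing increment of the first player.\<close>

lemma alternating_iterates_asymptotic_pseudotrajectory: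
  fixes \<eta> :: "nat \<Rightarrow> real" and a Ma ba :: "nat \<Rightarrow> 'a::euclidean_space" and b Mb bb :: "nat \<Rightarrow> 'b::euclidean_space"
    and fa :: "'a \<Rightarrow> 'b \<Rightarrow> 'a" and fb :: "'b \<Rightarrow> 'a \<Rightarrow> 'b"
  assumes Ka: "compact Ka" and Kb: "compact Kb" and U: "open U" "Ka \<times> Kb \<subseteq> U"
    and lipschitz: "L-lipschitz_on U (\<lambda>(a, b). (fa a b, fb b a))"
    and \<eta>_nonneg: "\<And>t. 1 \<le> t \<Longrightarrow> 0 \<le> \<eta> t"
    and \<eta>_sum: "filterlim (\<lambda>n. \<Sum>t=1..n. \<eta> t) at_top sequentially"
    and \<eta>_square: "summable (\<lambda>t. (\<eta> (Suc t))\<^sup>2)"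
    and in_K: "\<And>t. 1 \<le> t \<Longrightarrow> a t \<in> Ka \<and> b t \<in> Kb"
    and a_step: "\<And>t. 1 \<le> t \<Longrightarrow> a (Suc t) = a t + \<eta> t *\<^sub>R (fa (a t) (b t) + Ma (Suc t) + ba t)"
    and b_step: "\<And>t. 1 \<le> t \<Longrightarrow> b (Suc t) = b t + \<eta> t *\<^sub>R (fb (b t) (a (Suc t)) + Mb (Suc t) + bb t)"
    and Ma: "summable (\<lambda>t. \<eta> (Suc t) *\<^sub>R Ma (Suc (Suc t)))"
    and Mb: "summable (\<lambda>t. \<eta> (Suc t) *\<^sub>R Mb (Suc (Suc t)))"
    and bias: "summable (\<lambda>t. \<eta> (Suc t) * (norm (ba (Suc t)) + norm (bb (Suc t))))"
  shows "asymptotic_pseudotrajectory U (\<lambda>(a, b). (fa a b, fb b a)) (interpolation \<eta> (\<lambda>t. (a t, b t)))"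
proof -
  let ?F = "\<lambda>(a, b). (fa a b, fb b a)"
  define c where "c t = (\<eta> t *\<^sub>R (Ma (Suc t) + ba t), \<eta> t *\<^sub>R (Mb (Suc t) + bb t))" for t
  define d where "d t = (0 :: 'a, \<eta> t *\<^sub>R (fb (b t) (a (Suc t)) - fb (b t) (a t)))" for t
  define \<delta> where "\<delta> t = L * norm (a (Suc t) - a t)" for t
  have "(\<lambda>t. sqrt ((\<eta> (Suc t))\<^sup>2)) \<longlonglongrightarrow> sqrt 0"
    by (intro tendsto_real_sqrt summable_LIMSEQ_zero \<eta>_square)
  then have \<eta>_lim: "\<eta> \<longlonglongrightarrow> 0"
    by (simp add: tendsto_rabs_zero_iff filterlim_sequentially_Suc)
  have "summable (\<lambda>t. \<eta> (Suc t) *\<^sub>R ba (Suc t))" "summable (\<lambda>t. \<eta> (Suc t) *\<^sub>R bb (Suc t))"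
    by (rule summable_comparison_test'[OF bias, of 0]; use \<eta>_nonneg in \<open>simp add: mult_left_mono\<close>)+
  then have ca: "summable (\<lambda>t. \<eta> (Suc t) *\<^sub>R (Ma (Suc (Suc t)) + ba (Suc t)))"
    and cb: "summable (\<lambda>t. \<eta> (Suc t) *\<^sub>R (Mb (Suc (Suc t)) + bb (Suc t)))"
    using Ma Mb by (auto simp: scaleR_add_right intro: summable_add)
  have "bounded_linear (\<lambda>x. (x :: 'a, 0 :: 'b))" "bounded_linear (\<lambda>x. (0 :: 'a, x :: 'b))"
    by (intro bounded_linear_Pair bounded_linear_ident bounded_linear_zero)+
  from summable_add[OF bounded_linear.summable[OF this(1) ca] bounded_linear.summable[OF this(2) cb]]
  have "summable (\<lambda>t. c (Suc t))" by (simp add: c_def)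
  then have c: "summable c" by (simp add: summable_Suc_iff)
  have fb_le: "norm (fb (b t) (a (Suc t)) - fb (b t) (a t)) \<le> \<delta> t" if t: "1 \<le> t" for t
  proof -
    \<comment> \<open>The mixed point is not an iterate; it lies in \<open>U\<close> because the
      compact set is a product.\<close>
    have "(a (Suc t), b t) \<in> U" "(a t, b t) \<in> U"
      using in_K[OF t] in_K[of "Suc t"] U(2) by auto
    from lipschitz_onD[OF lipschitz this]
    have "dist (?F (a (Suc t), b t)) (?F (a t, b t)) \<le> L * dist (a (Suc t)) (a t)"
      by (simp add: dist_Pair_Pair)
    then show ?thesis
      using dist_snd_le[of "?F (a (Suc t), b t)" "?F (a t, b t)"]
      by (simp add: \<delta>_def dist_norm)
  qed
  have "bounded (?F ` (Ka \<times> Kb))"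
    by (intro compact_imp_bounded compact_continuous_image compact_Times Ka Kb
        continuous_on_subset[OF lipschitz_on_continuous_on[OF lipschitz] U(2)])
  then obtain B where B: "\<And>x. x \<in> Ka \<times> Kb \<Longrightarrow> norm (?F x) \<le> B"
    by (auto simp: bounded_iff)
  have a_le: "norm (a (Suc t) - a t) \<le> \<eta> t * B + norm (c t)" if t: "1 \<le> t" for t
  proof -
    have "norm (fa (a t) (b t)) \<le> B"
      using B[of "(a t, b t)"] norm_fst_le[of "fa (a t) (b t)" "fb (b t) (a t)"] in_K[OF t] by simp
    then have "norm (\<eta> t *\<^sub>R fa (a t) (b t)) \<le> \<eta> t * B"
      using \<eta>_nonneg[OF t] by (simp add: mult_left_mono)
    moreover have "norm (fst (c t)) \<le> norm (c t)" by (metis norm_fst_le prod.collapse)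
    moreover have "a (Suc t) - a t = \<eta> t *\<^sub>R fa (a t) (b t) + fst (c t)"
      using a_step[OF t] by (simp add: c_def algebra_simps)
    ultimately show ?thesis by (metis norm_triangle_mono)
  qed
  have "(\<lambda>t. \<eta> t * B + norm (c t)) \<longlonglongrightarrow> 0 * B + 0"
    by (intro tendsto_intros \<eta>_lim tendsto_norm_zero summable_LIMSEQ_zero c)
  then have "(\<lambda>t. \<eta> t * B + norm (c t)) \<longlonglongrightarrow> 0" by simp
  \<comment> \<open>This is shown before the locale is interpreted, since
    \<open>\<delta>_lim\<close> is one of its assumptions.\<close>
  then have "(\<lambda>t. a (Suc t) - a t) \<longlonglongrightarrow> 0"
    by (rule Lim_null_comparison[rotated]) (use a_le in \<open>auto simp: eventually_sequentially\<close>)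
  then have \<delta>_lim: "\<delta> \<longlonglongrightarrow> 0"
    unfolding \<delta>_def by (intro tendsto_mult_right_zero tendsto_norm_zero)
  interpret perturbed_euler \<eta> \<delta> "\<lambda>t. (a t, b t)" c d ?F "Ka \<times> Kb" U L
  proof
    fix t :: nat assume t: "1 \<le> t"
    show "(a (Suc t), b (Suc t)) = (a t, b t) + \<eta> t *\<^sub>R ?F (a t, b t) + c t + d t"
      using a_step[OF t] b_step[OF t] by (simp add: c_def d_def algebra_simps)
    show "norm (d t) \<le> \<eta> t * \<delta> t"
      using fb_le[OF t] \<eta>_nonneg[OF t] by (simp add: d_def norm_Pair mult_left_mono)
    show "(a (Suc t), b (Suc t)) = (a t, b t)" if "\<eta> t = 0"
      using a_step[OF t] b_step[OF t] that by simp
  qed (use assms c \<eta>_lim \<delta>_lim in \<open>auto intro: compact_Times\<close>)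
  show ?thesis by (rule asymptotic_pseudotrajectory_interpolation)
qed

theorem theorem3:
  fixes G :: "('task, 'u, 'out, 'p::euclidean_space, 'q::euclidean_space) game"
    and M :: "'w measure"
    and \<F> :: "nat \<Rightarrow> 'w measure"
    and \<phi> Mf bf :: "nat \<Rightarrow> 'w \<Rightarrow> 'p"
    and \<theta> Mv bv :: "nat \<Rightarrow> 'w \<Rightarrow> 'q"
    and \<eta> :: "nat \<Rightarrow> real"
    and Kf :: "'p set" and Kv :: "'q set" and U :: "('p \<times> 'q) set"
    and \<epsilon>\<^sub>A :: real
    and batch :: "nat \<Rightarrow> 'w \<Rightarrow> ('task, 'u, 'out) trajectory list"
  assumes "prob_space M"
    and "filtration (space M) \<F>"
    and "\<And>t. subalgebra M (\<F> t)"
    and "\<And>t. 1 \<le> t \<Longrightarrow> \<phi> t \<in> borel_measurable (\<F> t)"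
    and "\<And>t. 1 \<le> t \<Longrightarrow> \<theta> t \<in> borel_measurable (\<F> t)"
  \<comment> \<open>alternating updates\<close>
    and "AE \<omega> in M. \<forall>t\<ge>1.
           \<phi> (Suc t) \<omega> = \<phi> t \<omega> +
             \<eta> t *\<^sub>R (grad_generator G (\<phi> t \<omega>) (\<theta> t \<omega>) + Mf (Suc t) \<omega> + bf t \<omega>)"
    and "AE \<omega> in M. \<forall>t\<ge>1.
           \<theta> (Suc t) \<omega> = \<theta> t \<omega> +
             \<eta> t *\<^sub>R (grad_verifier G (\<theta> t \<omega>) (\<phi> (Suc t) \<omega>) + Mv (Suc t) \<omega> + bv t \<omega>)"
  \<comment> \<open>(i) smoothness and compactness\<close>
    and "compact Kf" and "compact Kv"
    and "AE \<omega> in M. \<forall>t\<ge>1. \<phi> t \<omega> \<in> Kf \<and> \<theta> t \<omega> \<in> Kv"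
    and "open U" and "Kf \<times> Kv \<subseteq> U"
    and "C1_lipschitz_gradient_on U (\<lambda>(\<phi>, \<theta>). generator_objective G \<phi> \<theta>)"
    and "C1_lipschitz_gradient_on U (\<lambda>(\<phi>, \<theta>). verifier_objective G \<theta> \<phi>)"
  \<comment> \<open>(ii) bounded rewards, advantages and noise\<close>
    and "\<exists>B. \<forall>m x y. \<bar>verifier_reward G m x y\<bar> \<le> B \<and>
           \<bar>grpo_advantage \<epsilon>\<^sub>A {SAC, NS} (verifier_reward G m x) y\<bar> \<le> B"
    and "\<exists>B. \<forall>m x z a. \<bar>generator_reward G m x z a\<bar> \<le> B \<and>
           \<bar>grpo_advantage \<epsilon>\<^sub>A {KEEP, REVISE} (generator_reward G m x z) a\<bar> \<le> B"
    and "bounded_second_moments M Mf" and "bounded_second_moments M Mv"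
    and "martingale_differences M \<F> Mf" and "martingale_differences M \<F> Mv"
  \<comment> \<open>(iii) step sizes\<close>
    and "\<And>t. 1 \<le> t \<Longrightarrow> 0 \<le> \<eta> t"
    and "filterlim (\<lambda>n. \<Sum>t=1..n. \<eta> t) at_top sequentially"
    and "summable (\<lambda>t. (\<eta> (Suc t))\<^sup>2)"
  \<comment> \<open>(iv) controlled bias\<close>
    and "AE \<omega> in M. summable (\<lambda>t. \<eta> (Suc t) * (norm (bf (Suc t) \<omega>) + norm (bv (Suc t) \<omega>)))"
  \<comment> \<open>(v) infinite visitation: both roles are updated in every iteration with a positive step;
      \<open>batch t\<close> is the (possibly replayed) game play used in iteration \<open>t\<close>\<close>
    and "infinite {t. 1 \<le> t \<and> 0 < \<eta> t}"
    and "AE \<omega> in M. \<forall>t\<ge>1. \<forall>\<tau>\<in>set (batch t \<omega>). \<exists>i\<in>{1..Suc t}. \<exists>j\<in>{1..t}.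
           \<tau> \<in> set_pmf (trajectory_pmf G (\<phi> i \<omega>) (\<theta> j \<omega>))"
    and "AE \<omega> in M. \<forall>y. infinite {t. 1 \<le> t \<and> visits y (batch t \<omega>)}"
    and "AE \<omega> in M.
           limsup (\<lambda>n. ereal (real (card {t\<in>{1..n}. visits SAC (batch t \<omega>)}) / real n)) > 0"
  shows "AE \<omega> in M.
    asymptotic_pseudotrajectory U (game_field G) (interpolation \<eta> (\<lambda>t. (\<phi> t \<omega>, \<theta> t \<omega>))) \<and>
    (\<forall>\<phi>' \<theta>'. (\<phi>', \<theta>') isolated_in limit_points (\<lambda>t. (\<phi> t \<omega>, \<theta> t \<omega>)) \<and>
        asymptotically_stable U (game_field G) (\<phi>', \<theta>') \<longrightarrow>
      grad_generator G \<phi>' \<theta>' = 0 \<and> grad_verifier G \<theta>' \<phi>' = 0 \<and> game_field G (\<phi>', \<theta>') = 0)"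
proof -
  obtain L where L: "L-lipschitz_on U (game_field G)"
    by (rule lipschitz_on_game_field[OF assms(13,14)])
  have noise_f: "AE \<omega> in M. summable (\<lambda>t. \<eta> (Suc t) *\<^sub>R Mf (Suc (Suc t)) \<omega>)"
    by (rule AE_summable_martingale_noise[OF assms(1-3,17,19,23)])
  have noise_v: "AE \<omega> in M. summable (\<lambda>t. \<eta> (Suc t) *\<^sub>R Mv (Suc (Suc t)) \<omega>)"
    by (rule AE_summable_martingale_noise[OF assms(1-3,18,20,23)])
  \<comment> \<open>From here the argument is pathwise, on the almost sure event where the
    recursions hold, the iterates stay in the compact sets, and the bias and noise series
    converge.\<close>
  show ?thesis
    using assms(6,7,10,24) noise_f noise_v
  proof eventually_elim
    case (elim \<omega>)
    have "asymptotic_pseudotrajectory U (\<lambda>(a, b). (grad_generator G a b, grad_verifier G b a))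
        (interpolation \<eta> (\<lambda>t. (\<phi> t \<omega>, \<theta> t \<omega>)))"
    proof (rule alternating_iterates_asymptotic_pseudotrajectory)
      show "L-lipschitz_on U (\<lambda>(a, b). (grad_generator G a b, grad_verifier G b a))"
        using L unfolding game_field_def .
      fix t :: nat assume t: "1 \<le> t"
      show "\<phi> (Suc t) \<omega> = \<phi> t \<omega> +
          \<eta> t *\<^sub>R (grad_generator G (\<phi> t \<omega>) (\<theta> t \<omega>) + Mf (Suc t) \<omega> + bf t \<omega>)"
        using elim(1) t by blast
      show "\<theta> (Suc t) \<omega> = \<theta> t \<omega> +
          \<eta> t *\<^sub>R (grad_verifier G (\<theta> t \<omega>) (\<phi> (Suc t) \<omega>) + Mv (Suc t) \<omega> + bv t \<omega>)"
        using elim(2) t by blast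
      show "\<phi> t \<omega> \<in> Kf \<and> \<theta> t \<omega> \<in> Kv"
        using elim(3) t by blast
    qed (fact assms(8,9,11,12,21-23) elim(4-6))+
    then have "asymptotic_pseudotrajectory U (game_field G) (interpolation \<eta> (\<lambda>t. (\<phi> t \<omega>, \<theta> t \<omega>)))"
      unfolding game_field_def .
    moreover have "grad_generator G \<phi>' \<theta>' = 0 \<and> grad_verifier G \<theta>' \<phi>' = 0 \<and> game_field G (\<phi>', \<theta>') = 0"
      if "asymptotically_stable U (game_field G) (\<phi>', \<theta>')" for \<phi>' \<theta>'
    proof -
      have "game_field G (\<phi>', \<theta>') = 0"
        by (rule asymptotically_stable_imp_zero[OF lipschitz_on_continuous_on[OF L] that])
      then show ?thesis by (simp add: game_field_def zero_prod_def)
    qed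
    ultimately show ?case by blast
  qed
qed

end
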